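(* Let $q\ge 8$ be even, $\mu\in\mathbb F_q^*\setminus\{1\}$, and let $\mathcal O_\mu$ be the $G_q$-orbit of $\ell_\mu$. Then $\Pi_\Gamma=\Lambda_\Gamma=P_{\mathcal C}=L_{\mathcal C}=0$ and $P_T=2$, $P_{3_\Gamma}=\tfrac13(q-3-N_1(\mu))$, $P_{1_\Gamma}=N_1(\mu)$, $P_{0_\Gamma}=\tfrac23(q-N_1(\mu))$; $L_T=q-1$, $L_{3_\Gamma}=q-3-N_1(\mu)$, $L_{1_\Gamma}=N_1(\mu)$, $L_{0_\Gamma}=q-N_1(\mu)$; $\Pi_{2_{\mathcal C}}=2$, $\Pi_{3_{\mathcal C}}=\tfrac13(q-3-\widetilde N_1(\mu))$, $\Pi_{\overline{1_{\mathcal C}}}=\widetilde N_1(\mu)$, $\Pi_{0_{\mathcal C}}=\tfrac23(q-\widetilde N_1(\mu))$; $\Lambda_{2_{\mathcal C}}=q-1$, $\Lambda_{3_{\mathcal C}}=q-3-\widetilde N_1(\mu)$, $\Lambda_{\overline{1_{\mathcal C}}}=\widetilde N_1(\mu)$, $\Lambda_{0_{\mathcal C}}=q-\widetilde N_1(\mu)$.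
   Context: Let $\mathbb F_q$ be the field of order $q$ and $\mathrm{PG}(3,q)$ the projective space with points $\mathbf P(x_0,x_1,x_2,x_3)$. For $t\in\mathbb F_q$ put $P(t)=\mathbf P(t^3,t^2,t,1)$, and $P(\infty)=\mathbf P(1,0,0,0)$; the twisted cubic is $\mathcal C=\{P(t):t\in\mathbb F_q\cup\{\infty\}\}$ and $G_q$ is the group of projectivities fixing $\mathcal C$. The osculating plane at $P(t)$ is $t$-plane $x_0-3tx_1+3t^2x_2-t^3x_3=0$ ($t\in\mathbb F_q$) and $x_3=0$ at $P(\infty)$; these are the $\Gamma$-planes. The tangent at $P(t)$, $t\in\mathbb F_q$, is the line through $P(t)$ and $\mathbf P(3t^2,2t,1,0)$; at $P(\infty)$ it is the line through $\mathbf P(1,0,0,0),\mathbf P(0,1,0,0)$. Plane types: a $d_{\mathcal C}$-plane ($d\in\{0,2,3\}$) contains exactly $d$ points of $\mathcal C$; a $\overline{1_{\mathcal C}}$-plane is a non-$\Gamma$-plane containing exactly one point of $\mathcal C$ (orbit sizes $q^2+q$, $(q^3-q)/6$, $(q^3-q)/2$, $(q^3-q)/3$ for $2_{\mathcal C},3_{\mathcal C},\overline{1_{\mathcal C}},0_{\mathcal C}$). Point types: $\mathcal C$-points; $T$-points: points off $\mathcal C$ on a tangent; $\mu_\Gamma$-points ($\mu\in\{0,1,3\}$): points off $\mathcal C$ in exactly $\mu$ distinct $\Gamma$-planes (orbit sizes $q^2+q$, $(q^3-q)/6$, $(q^3-q)/2$, $(q^3-q)/3$ for $T,3_\Gamma,1_\Gamma,0_\Gamma$).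 For a $G_q$-orbit $\mathcal O$ of lines, $\Pi_\pi$ = number of $\pi$-planes through a line of $\mathcal O$, $\Lambda_\pi$ = number of lines of $\mathcal O$ in a $\pi$-plane, $P_{\mathfrak p}$ = number of $\mathfrak p$-points on a line of $\mathcal O$, $L_{\mathfrak p}$ = number of lines of $\mathcal O$ through a $\mathfrak p$-point (all independent of the choices). $\ell_\mu$ is the line through $\mathbf P(0,\mu,0,1)$ and $\mathbf P(1,0,1,0)$, i.e. $\{\mathbf P(\gamma,\mu,\gamma,1):\gamma\in\mathbb F_q\}\cup\{\mathbf P(1,0,1,0)\}$; for even $q$ it is known that $\#\mathcal O_\mu=(q^3-q)/2$. $N_1(\mu)$ is the number of $\gamma\in\mathbb F_q$ such that $t^3+\gamma t^2+\mu t+\gamma=0$ has exactly one solution $t\in\mathbb F_q$; $\widetilde N_1(\mu)$ is the number of $c\in\mathbb F_q^*$ such that $t^3+ct^2+t+\mu c=0$ has exactly one solution $t\in\mathbb F_q$. *)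

theory Defs
  imports Main
begin

text \<open>Vectors of F_q^4 are modelled as functions nat => 'a that vanish from index 4 on.\<close>
type_synonym 'a vec4 = "nat \<Rightarrow> 'a"

definition vecs :: "('a::zero) vec4 set" where
  "vecs = {v. \<forall>i\<ge>4. v i = 0}"

definition nz :: "('a::zero) vec4 \<Rightarrow> bool" where
  "nz v \<longleftrightarrow> (\<exists>i<4. v i \<noteq> 0)"

definition v4 :: "'a \<Rightarrow> 'a \<Rightarrow> 'a \<Rightarrow> 'a \<Rightarrow> ('a::zero) vec4" where
  "v4 a b c d = (\<lambda>i. if i = 0 then a else if i = 1 then b else if i = 2 then c
                      else if i = 3 then d else 0)"

definition pt :: "('a::field) vec4 \<Rightarrow> 'a vec4 set" where
  "pt v = {(\<lambda>i. c * v i) | c. c \<noteq> 0}"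

definition PG3 :: "('a::field) vec4 set set" where
  "PG3 = {pt v | v. v \<in> vecs \<and> nz v}"

text \<open>The line through P(u) and P(w) (u, w linearly independent), as a set of points.\<close>
definition line_of :: "('a::field) vec4 \<Rightarrow> 'a vec4 \<Rightarrow> 'a vec4 set set" where
  "line_of u w = {pt (\<lambda>i. a * u i + b * w i) | a b. a \<noteq> 0 \<or> b \<noteq> 0}"

definition plane :: "('a::field) vec4 \<Rightarrow> 'a vec4 set set" where
  "plane a = {pt v | v. v \<in> vecs \<and> nz v \<and> (\<Sum>i<4. a i * v i) = 0}"

definition planes :: "('a::field) vec4 set set set" where
  "planes = {plane a | a. a \<in> vecs \<and> nz a}"

definition Pc :: "'a \<Rightarrow> ('a::field) vec4 set" where
  "Pc t = pt (v4 (t^3) (t^2) t 1)"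

definition Pinf :: "('a::field) vec4 set" where
  "Pinf = pt (v4 1 0 0 0)"

definition tcubic :: "('a::field) vec4 set set" where
  "tcubic = range Pc \<union> {Pinf}"

definition mapv :: "(nat \<Rightarrow> nat \<Rightarrow> 'a) \<Rightarrow> ('a::field) vec4 \<Rightarrow> 'a vec4" where
  "mapv M v = (\<lambda>i. if i < 4 then (\<Sum>j<4. M i j * v j) else 0)"

definition invertible4 :: "(nat \<Rightarrow> nat \<Rightarrow> ('a::field)) \<Rightarrow> bool" where
  "invertible4 M \<longleftrightarrow> (\<exists>N. \<forall>v\<in>vecs. mapv N (mapv M v) = v \<and> mapv M (mapv N v) = v)"

definition actP :: "(nat \<Rightarrow> nat \<Rightarrow> ('a::field)) \<Rightarrow> 'a vec4 set \<Rightarrow> 'a vec4 set" where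
  "actP M P = mapv M ` P"

definition actS :: "(nat \<Rightarrow> nat \<Rightarrow> ('a::field)) \<Rightarrow> 'a vec4 set set \<Rightarrow> 'a vec4 set set" where
  "actS M S = actP M ` S"

definition Gq :: "(nat \<Rightarrow> nat \<Rightarrow> ('a::field)) set" where
  "Gq = {M. invertible4 M \<and> actS M tcubic = tcubic}"

definition line_orbit :: "('a::field) vec4 set set \<Rightarrow> 'a vec4 set set set" where
  "line_orbit L = {actS M L | M. M \<in> Gq}"

definition ell :: "('a::field) \<Rightarrow> 'a vec4 set set" where
  "ell mu = line_of (v4 0 mu 0 1) (v4 1 0 1 0)"

definition osc :: "('a::field) \<Rightarrow> 'a vec4 set set" where
  "osc t = plane (v4 1 (- (3 * t)) (3 * t^2) (- (t^3)))"

definition gamma_planes :: "('a::field) vec4 set set set" where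
  "gamma_planes = range osc \<union> {plane (v4 0 0 0 1)}"

definition tangent :: "('a::field) \<Rightarrow> 'a vec4 set set" where
  "tangent t = line_of (v4 (t^3) (t^2) t 1) (v4 (3 * t^2) (2 * t) 1 0)"

definition tangents :: "('a::field) vec4 set set set" where
  "tangents = range tangent \<union> {line_of (v4 1 0 0 0) (v4 0 1 0 0)}"

definition T_point :: "('a::field) vec4 set \<Rightarrow> bool" where
  "T_point P \<longleftrightarrow> P \<in> PG3 \<and> P \<notin> tcubic \<and> (\<exists>L\<in>tangents. P \<in> L)"

definition Gamma_point :: "nat \<Rightarrow> ('a::field) vec4 set \<Rightarrow> bool" where
  "Gamma_point m P \<longleftrightarrow> P \<in> PG3 \<and> P \<notin> tcubic \<and> \<not> T_point P
      \<and> card {\<pi> \<in> gamma_planes. P \<in> \<pi>} = m"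

text \<open>Plane types: C_plane d = d_C-plane (d = 0,2,3); C_plane 1 = the 1-bar_C-planes.\<close>
definition C_plane :: "nat \<Rightarrow> ('a::field) vec4 set set \<Rightarrow> bool" where
  "C_plane d \<pi> \<longleftrightarrow> \<pi> \<in> planes \<and> \<pi> \<notin> gamma_planes \<and> card (\<pi> \<inter> tcubic) = d"

definition N1 :: "('a::{field,finite}) \<Rightarrow> nat" where
  "N1 mu = card {g. card {t. t^3 + g * t^2 + mu * t + g = 0} = 1}"

definition N1t :: "('a::{field,finite}) \<Rightarrow> nat" where
  "N1t mu = card {c. c \<noteq> 0 \<and> card {t. t^3 + c * t^2 + t + mu * c = 0} = 1}"

end

theory Submission
  imports Defs "HOL-Computational_Algebra.Polynomial"
begin

text \<open>In characteristic 2 a point \<open>v\<close> is the binary cubic \<open>v\<^sub>3 t\<^sup>3 + v\<^sub>2 t\<^sup>2 + v\<^sub>1 t + v\<^sub>0\<close>, whose roots in the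
  projective line are the \<open>\<Gamma>\<close>-planes through the point. Cubics with a repeated root form the quadric
  \<open>v\<^sub>0 v\<^sub>3 + v\<^sub>1 v\<^sub>2 = 0\<close>; its polar form is the null polarity exchanging \<open>C\<close> with the \<open>\<Gamma>\<close>-planes, and
  it maps the orbit of \<open>\<ell>\<^sub>\<mu>\<close> to that of \<open>\<ell>\<^bsub>1/\<mu>\<^esub>\<close>, so the statements on planes are dual to those on points.
  Comparing coefficients of polynomials of degree at most 6 < q identifies \<open>G\<^sub>q\<close> with \<open>SL(2,q)\<close>, which
  acts on the cubics with \<open>v\<^sub>0 v\<^sub>3 + v\<^sub>1 v\<^sub>2 = 1\<close>. Bounds on stabilizers, together with
  the numbers of such cubics with 0, 1 or 3 roots, show that each type is a single orbit.
  The points on \<open>\<ell>\<^sub>\<mu>\<close> are counted directly, its stabilizer has order 2, and the numbers of lines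
  through a point follow by double counting incidences.\<close>

section \<open>Points and forms\<close>

text \<open>In characteristic 2 the space of cubics is the tensor product of the Frobenius twist of
  the plane with the plane itself: \<open>cub x\<close> is x^(2) tensor x, and \<open>qform\<close>
  is the determinant of a tensor. Hence the invariant quadric: its points are the pure tensors, the
  cubic is the diagonal, and the tangents form one ruling. Squaring is bijective, so every point off
  the quadric has exactly one representative with \<open>qform\<close> equal to 1, and counting
  points becomes counting vectors. The delicate point is transitivity on cubics without roots, whose
  natural treatment lives over a cubic extension. Staying in F_q, an upper bound s for one
  stabilizer together with s * |X| = |SL(2,q)| forces the orbit to fill X, so no group element
  joining two irreducible cubics has to be exhibited. The condition mu different from 1 keeps the
  line from lying inside the quadric; it then meets the quadric in just two points, and these pin
  down its stabilizer.\<close>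

lemma v4_simps [simp]:
  "v4 a b c d 0 = a" "v4 a b c d (Suc 0) = b" "v4 a b c d 1 = b" "v4 a b c d 2 = c"
  "v4 a b c d 3 = d"
  by (simp_all add: v4_def)

lemma v4_in_vecs [simp]: "v4 a b c d \<in> vecs"
  by (simp add: vecs_def v4_def)

lemma v4_eq_iff [simp]:
  "v4 a b c d = v4 a' b' c' d' \<longleftrightarrow> a = a' \<and> b = b' \<and> c = c' \<and> d = d'"
  by (metis v4_simps)

lemma vecs_eq_v4: "v \<in> vecs \<Longrightarrow> v = v4 (v 0) (v 1) (v 2) (v 3)"
proof (rule ext)
  fix i :: nat assume "v \<in> vecs"
  consider "i = 0" | "i = 1" | "i = 2" | "i = 3" | "i \<ge> 4" by linarith
  then show "v i = v4 (v 0) (v 1) (v 2) (v 3) i"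
    by cases (use \<open>v \<in> vecs\<close> in \<open>auto simp: vecs_def v4_def\<close>)
qed

lemma vecsE:
  assumes "v \<in> vecs" obtains a b c d where "v = v4 a b c d"
  using vecs_eq_v4[OF assms] by blast

lemma nz_v4 [simp]: "nz (v4 a b c d) \<longleftrightarrow> a \<noteq> 0 \<or> b \<noteq> 0 \<or> c \<noteq> 0 \<or> d \<noteq> 0"
proof -
  have "i < 4 \<longleftrightarrow> i = 0 \<or> i = 1 \<or> i = 2 \<or> i = 3" for i :: nat by auto
  then have "nz v \<longleftrightarrow> v 0 \<noteq> 0 \<or> v 1 \<noteq> 0 \<or> v 2 \<noteq> 0 \<or> v 3 \<noteq> 0" for v :: "'a vec4"
    unfolding nz_def by auto
  then show ?thesis by simp
qed

definition smul :: "'a::field \<Rightarrow> 'a vec4 \<Rightarrow> 'a vec4" where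
  "smul k v = (\<lambda>i. k * v i)"

lemma smul_v4 [simp]: "smul k (v4 a b c d) = v4 (k * a) (k * b) (k * c) (k * d)"
  by (rule ext) (simp add: smul_def v4_def)

lemma smul_nth [simp]: "smul k v i = k * v i"
  by (simp add: smul_def)

lemma lincomb_v4 [simp]:
  "(\<lambda>i. k * v4 a b c d i + l * v4 a' b' c' d' i)
    = v4 (k * a + l * a') (k * b + l * b') (k * c + l * c') (k * d + (l::'a::field) * d')"
  by (rule ext) (simp add: v4_def)

lemma pt_conv_smul: "pt v = {smul k v | k. k \<noteq> 0}"
  by (simp add: pt_def smul_def)

lemma pt_self [simp]: "v \<in> pt v"
  unfolding pt_def by (rule CollectI, rule exI[of _ 1]) auto

lemma pt_eq_iff: "pt u = pt v \<longleftrightarrow> (\<exists>k. k \<noteq> 0 \<and> u = smul k v)"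
proof
  assume "pt u = pt v"
  then show "\<exists>k. k \<noteq> 0 \<and> u = smul k v"
    using pt_self[of u] unfolding pt_conv_smul[of v] by auto
next
  assume "\<exists>k. k \<noteq> 0 \<and> u = smul k v"
  then obtain k where k: "k \<noteq> 0" "u = smul k v" by blast
  have "smul c u = smul (c * k) v" for c
    using k by (simp add: smul_def mult.assoc)
  then have 1: "pt u \<subseteq> pt v"
    unfolding pt_conv_smul using k(1) by (smt (verit) Collect_mono mult_eq_0_iff)
  have "smul c v = smul (c / k) u" for c
    using k by (simp add: smul_def)
  then have "pt v \<subseteq> pt u"
    unfolding pt_conv_smul using k(1) by (smt (verit) Collect_mono divide_eq_0_iff)
  with 1 show "pt u = pt v" by blast
qed

lemma pt_smul [simp]: "k \<noteq> 0 \<Longrightarrow> pt (smul k v) = pt v"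
  by (auto simp: pt_eq_iff)

lemma pt_in_PG3 [simp]: "v \<in> vecs \<Longrightarrow> nz v \<Longrightarrow> pt v \<in> PG3"
  by (auto simp: PG3_def)

lemma PG3E:
  assumes "P \<in> PG3" obtains a b c d where "P = pt (v4 a b c d)" "nz (v4 a b c d)"
  using assms unfolding PG3_def by (auto elim!: vecsE)

lemma pt_subset_vecs: "v \<in> vecs \<Longrightarrow> pt v \<subseteq> vecs"
  by (auto simp: pt_def vecs_def)

lemma PG3_subset_vecs: "P \<in> PG3 \<Longrightarrow> P \<subseteq> vecs"
  using pt_subset_vecs by (auto simp: PG3_def)

lemma finite_vecs: "finite (vecs :: 'a::{field,finite} vec4 set)"
proof -
  have "vecs \<subseteq> range (\<lambda>(a, b, c, d). v4 a b c (d::'a))"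
  proof
    fix v :: "'a vec4" assume "v \<in> vecs"
    then show "v \<in> range (\<lambda>(a, b, c, d). v4 a b c (d::'a))"
      by (intro image_eqI[where x = "(v 0, v 1, v 2, v 3)"], unfold prod.case) (rule vecs_eq_v4, auto)
  qed
  then show ?thesis by (rule finite_subset) simp
qed

lemma finite_PG3: "finite (PG3 :: 'a::{field,finite} vec4 set set)"
  using PG3_subset_vecs by (intro finite_subset[OF _ finite_Pow_iff[THEN iffD2, OF finite_vecs]]) blast

definition qform :: "'a::field vec4 \<Rightarrow> 'a" where
  "qform v = v 0 * v 3 + v 1 * v 2"

text \<open>This is the polarization of \<open>qform\<close>. In characteristic 2 it is alternating
  as well as symmetric, so every point lies on its own polar plane. All signs are written as
  plus.\<close>

definition bform :: "'a::field vec4 \<Rightarrow> 'a vec4 \<Rightarrow> 'a" where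
  "bform u v = u 0 * v 3 + u 3 * v 0 + u 1 * v 2 + u 2 * v 1"

lemma qform_v4 [simp]: "qform (v4 a b c d) = a * d + b * c"
  by (simp add: qform_def)

lemma bform_v4 [simp]:
  "bform (v4 a b c d) (v4 a' b' c' d') = a * d' + d * a' + b * c' + c * b'"
  by (simp add: bform_def)

lemma bform_smul [simp]: "bform (smul k u) v = k * bform u v" "bform u (smul k v) = k * bform u v"
  by (simp_all add: bform_def algebra_simps)

lemma qform_smul [simp]: "qform (smul k v) = k^2 * qform v"
  by (simp add: qform_def algebra_simps power2_eq_square)

lemma bform_commute: "bform u v = bform v u"
  by (simp add: bform_def algebra_simps)

text \<open>In homogeneous coordinates on the projective line, the cubic form with double root \<open>x\<close> and
  simple root \<open>y\<close>.\<close>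

definition tens :: "'a \<times> 'a \<Rightarrow> 'a \<times> 'a \<Rightarrow> 'a::field vec4" where
  "tens x y = v4 (fst x^2 * fst y) (fst x^2 * snd y) (snd x^2 * fst y) (snd x^2 * snd y)"

text \<open>The projective line is the type \<open>'a option\<close> with \<open>None\<close> for
  infinity, so that sums over all q + 1 parameters range over a finite type.\<close>

definition hom :: "'a::field option \<Rightarrow> 'a \<times> 'a" where
  "hom x = (case x of None \<Rightarrow> (1, 0) | Some t \<Rightarrow> (t, 1))"

lemma hom_simps [simp]: "hom None = (1, 0)" "hom (Some t) = (t, 1)"
  by (simp_all add: hom_def)

definition cub :: "'a::field option \<Rightarrow> 'a vec4" where
  "cub x = tens (hom x) (hom x)"

lemma cub_simps [simp]: "cub None = v4 1 0 0 0" "cub (Some t) = v4 (t^3) (t^2) t 1"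
  by (simp_all add: cub_def tens_def power2_eq_square power3_eq_cube)

lemma tcubic_eq: "tcubic = range (\<lambda>x. pt (cub x))"
proof -
  have "range (\<lambda>x. pt (cub x)) = insert (pt (cub None)) (range (\<lambda>t. pt (cub (Some (t::'a)))))"
    by (auto simp: image_iff) (metis option.exhaust cub_simps)+
  then show ?thesis by (auto simp: tcubic_def Pc_def Pinf_def)
qed

lemma cub_in_vecs [simp]: "cub x \<in> vecs" and nz_cub [simp]: "nz (cub x)"
  by (cases x; simp)+

lemma inj_pt_cub: "inj (\<lambda>x. pt (cub x))"
proof (rule injI)
  fix x y :: "'a option" assume "pt (cub x) = pt (cub y)"
  then show "x = y"
    unfolding pt_eq_iff by (cases x; cases y) auto
qed

text \<open>Pairing with \<open>cub x\<close> evaluates the cubic at \<open>x\<close>;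
  \<open>None\<close> is a root exactly when the coefficient of t^3 vanishes. Roots are counted
  without multiplicity.\<close>

definition nroots :: "'a::field vec4 \<Rightarrow> nat" where
  "nroots v = card {x. bform v (cub x) = 0}"

lemma nroots_smul [simp]: "k \<noteq> 0 \<Longrightarrow> nroots (smul k v) = nroots v"
  by (simp add: nroots_def)

section \<open>The action of SL(2,q) on binary cubics\<close>

type_synonym 'a mat2 = "'a \<times> 'a \<times> 'a \<times> 'a"

text \<open>Over a field of characteristic 2, this is \<open>SL(2,q) = PGL(2,q)\<close> acting on
  binary cubic forms, with sign-free determinant and inverse.\<close>

definition SL2 :: "'a::field mat2 set" where
  "SL2 = {(a, b, c, d). a * d + b * c = 1}"

fun mmul :: "'a::field mat2 \<Rightarrow> 'a mat2 \<Rightarrow> 'a mat2" where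
  "mmul (a, b, c, d) (a', b', c', d') =
     (a * a' + b * c', a * b' + b * d', c * a' + d * c', c * b' + d * d')"

fun minv :: "'a::field mat2 \<Rightarrow> 'a mat2" where
  "minv (a, b, c, d) = (d, b, c, a)"

fun mapp :: "'a::field mat2 \<Rightarrow> 'a \<times> 'a \<Rightarrow> 'a \<times> 'a" where
  "mapp (a, b, c, d) (s, r) = (a * s + b * r, c * s + d * r)"

text \<open>The coefficients form the Kronecker product of the entrywise square of the 2 x 2 matrix
  with the matrix itself. On \<open>cub\<close> vectors it is the usual cubed substitution, because
  the binomial coefficient 3 equals 1.\<close>

fun act :: "'a::field mat2 \<Rightarrow> 'a vec4 \<Rightarrow> 'a vec4" where
  "act (a, b, c, d) v = v4
     (a^3 * v 0 + a^2 * b * v 1 + a * b^2 * v 2 + b^3 * v 3)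
     (a^2 * c * v 0 + a^2 * d * v 1 + b^2 * c * v 2 + b^2 * d * v 3)
     (a * c^2 * v 0 + b * c^2 * v 1 + a * d^2 * v 2 + b * d^2 * v 3)
     (c^3 * v 0 + c^2 * d * v 1 + c * d^2 * v 2 + d^3 * v 3)"

lemma act_in_vecs [simp]: "act g v \<in> vecs"
  by (cases g) simp

lemma act_smul [simp]: "act g (smul k v) = smul k (act g v)"
  by (cases g) (simp add: algebra_simps)

definition pact :: "'a::field mat2 \<Rightarrow> 'a vec4 set \<Rightarrow> 'a vec4 set" where
  "pact g P = act g ` P"

definition sact :: "'a::field mat2 \<Rightarrow> 'a vec4 set set \<Rightarrow> 'a vec4 set set" where
  "sact g L = pact g ` L"

lemma pact_pt [simp]: "pact g (pt v) = pt (act g v)"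
  unfolding pact_def pt_conv_smul by (auto simp: image_iff) (metis act_smul)

section \<open>Fields of even order: characteristic 2 and square roots\<close>

lemma even_card_involution:
  assumes "finite A" "\<And>x. x \<in> A \<Longrightarrow> f x \<in> A" "\<And>x. x \<in> A \<Longrightarrow> f (f x) = x"
    "\<And>x. x \<in> A \<Longrightarrow> f x \<noteq> x"
  shows "even (card A)"
  using assms
proof (induction "card A" arbitrary: A rule: less_induct)
  case less
  show ?case
  proof (cases "A = {}")
    case False
    then obtain x where x: "x \<in> A" by blast
    let ?B = "A - {x, f x}"
    have c: "card A = card ?B + 2"
    proof -
      have "card {x, f x} = 2" using less.prems(4)[OF x] by auto
      moreover have "{x, f x} \<subseteq> A" using x less.prems(2) by auto
      ultimately show ?thesis
        using card_Diff_subset[of "{x, f x}" A] card_mono[OF less.prems(1), of "{x, f x}"] by simp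
    qed
    have "even (card ?B)"
    proof (rule less.hyps)
      fix y assume y: "y \<in> ?B"
      then show "f y \<in> ?B" using less.prems(2,3) x by (metis Diff_iff insert_iff empty_iff)
    qed (use c less.prems in auto)
    then show ?thesis using c by simp
  qed simp
qed

locale even_field =
  fixes ty :: "'a::{field,finite} itself"
  assumes even_card: "even (card (UNIV :: 'a set))"
begin

text \<open>If 2 were nonzero, negation would pair off the nonzero elements without fixed points,
  and the order of the field would be odd.\<close>

lemma two_eq_0 [simp]: "(2::'a) = 0"
proof (rule ccontr)
  assume two: "(2::'a) \<noteq> 0"
  have "even (card (UNIV - {0::'a}))"
  proof (rule even_card_involution[where f = uminus])
    fix x :: 'a assume "x \<in> UNIV - {0}"
    then show "- x \<noteq> x"
      using two by (metis DiffD2 add.right_inverse insertCI mult_2 mult_eq_0_iff)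
  qed auto
  moreover have "card (UNIV :: 'a set) = card (UNIV - {0::'a}) + 1"
    by (metis Suc_eq_plus1 UNIV_I card_Suc_Diff1 finite_class.finite_UNIV)
  ultimately show False using even_card by (metis even_plus_one_iff)
qed

lemma add_self [simp]: "(x::'a) + x = 0"
  using two_eq_0 by (metis mult_2 mult_zero_left)

lemma add_self_left [simp]: "(x::'a) + (x + y) = y"
  by (simp flip: add.assoc)

lemma three_eq_1 [simp]: "(3::'a) = 1"
  by (metis add_0 two_eq_0 numeral_plus_one semiring_norm(5))

lemma uminus_eq [simp]: "- (x::'a) = x"
  by (metis add_self add.right_inverse add_left_cancel)

lemma add_eq_0_iff_eq: "(x::'a) + y = 0 \<longleftrightarrow> x = y"
  by (metis add_self add_left_cancel)

lemma sq_add: "((x::'a) + y)^2 = x^2 + y^2"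
  by (simp add: power2_sum)

lemma sq_eq_iff [simp]: "(x::'a)^2 = y^2 \<longleftrightarrow> x = y"
  by (metis add_eq_0_iff_eq sq_add zero_eq_power2)

text \<open>Squaring is additive with trivial kernel, hence injective, hence surjective on a finite
  field.\<close>

lemma sqrt_exists: obtains s where "s^2 = (x::'a)"
proof -
  have "inj (\<lambda>x::'a. x^2)" by (auto intro: injI)
  then have "surj (\<lambda>x::'a. x^2)" by (rule finite_UNIV_inj_surj[OF finite_class.finite_UNIV])
  then show ?thesis using that by (metis surjE)
qed

lemma act_tens: "act (g::'a mat2) (tens x y) = tens (mapp g x) (mapp g y)"
  by (cases g; cases x; cases y)
    (simp add: tens_def algebra_simps power2_eq_square power3_eq_cube)

lemma act_mmul: "act (g::'a mat2) (act h v) = act (mmul g h) v"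
  by (cases g; cases h) (simp add: algebra_simps power2_eq_square power3_eq_cube)

lemma act_one: "(v::'a vec4) \<in> vecs \<Longrightarrow> act (1, 0, 0, 1) v = v"
  by (rule trans[OF _ vecs_eq_v4[symmetric]]) simp_all

lemma mmul_SL2: "(g::'a mat2) \<in> SL2 \<Longrightarrow> h \<in> SL2 \<Longrightarrow> mmul g h \<in> SL2"
proof (cases g; cases h)
  fix a b c d a' b' c' d' :: 'a
  assume *: "g \<in> SL2" "h \<in> SL2" "g = (a, b, c, d)" "h = (a', b', c', d')"
  have "(a * a' + b * c') * (c * b' + d * d') + (a * b' + b * d') * (c * a' + d * c')
     = (a * d + b * c) * (a' * d' + b' * c')"
    by (simp add: algebra_simps)
  then show "mmul g h \<in> SL2" using * by (simp add: SL2_def)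
qed

lemma minv_SL2: "(g::'a mat2) \<in> SL2 \<Longrightarrow> minv g \<in> SL2"
  by (cases g) (simp add: SL2_def mult.commute)

lemma one_SL2: "(1, 0, 0, 1) \<in> (SL2 :: 'a mat2 set)"
  by (simp add: SL2_def)

lemma mmul_minv:
  assumes "(g::'a mat2) \<in> SL2"
  shows "mmul (minv g) g = (1, 0, 0, 1)" "mmul g (minv g) = (1, 0, 0, 1)"
  using assms by (cases g; simp add: SL2_def algebra_simps)+

lemma act_minv:
  assumes "(g::'a mat2) \<in> SL2" "v \<in> vecs"
  shows "act (minv g) (act g v) = v" "act g (act (minv g) v) = v"
  unfolding act_mmul mmul_minv[OF assms(1)] by (rule act_one[OF assms(2)])+

lemma qform_act:
  assumes "(g::'a mat2) \<in> SL2" "v \<in> vecs" shows "qform (act g v) = qform v"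
proof -
  obtain a b c d where g: "g = (a, b, c, d)" by (cases g)
  obtain p q r s where v: "v = v4 p q r s" using assms by (elim vecsE)
  have "qform (act g v) = (a * d + b * c)^3 * qform v"
    unfolding g v by (simp add: algebra_simps power2_eq_square power3_eq_cube)
  then show ?thesis using assms g by (simp add: SL2_def)
qed

lemma bform_act:
  assumes "(g::'a mat2) \<in> SL2" "u \<in> vecs" "v \<in> vecs"
  shows "bform (act g u) (act g v) = bform u v"
proof -
  obtain a b c d where g: "g = (a, b, c, d)" by (cases g)
  obtain p q r s where v: "v = v4 p q r s" using assms by (elim vecsE)
  obtain p' q' r' s' where u: "u = v4 p' q' r' s'" using assms by (elim vecsE)
  have "bform (act g u) (act g v) = (a * d + b * c)^3 * bform u v"
    unfolding g v u by (simp add: algebra_simps power2_eq_square power3_eq_cube)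
  then show ?thesis using assms g by (simp add: SL2_def)
qed

text \<open>The matrix is built from the two coordinate vectors by Cramer's rule. Elements of
  \<open>SL2\<close> preserve the determinant \<open>k\<close> of these two vectors, so the second
  one can be normalized only up to this factor.\<close>

lemma mapp_move2:
  assumes "x \<noteq> (y :: 'a option)"
  obtains g k where "g \<in> SL2" "k \<noteq> 0" "mapp g (hom x) = (1, 0)" "mapp g (hom y) = (0, k)"
proof -
  obtain s r s' r' where h: "hom x = (s, r)" "hom y = (s', r')" by fastforce
  define k where "k = s * r' + r * s'"
  have k: "k \<noteq> 0"
    using h assms by (cases x; cases y) (auto simp: k_def add_eq_0_iff_eq)
  have "r' / k * s + s' / k * r = 1"
  proof -
    have "r' / k * s + s' / k * r = (s * r' + r * s') / k"
      by (simp add: add_divide_distrib mult.commute)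
    then show ?thesis using k by (simp add: k_def)
  qed
  then show ?thesis
    using k h by (intro that[of "(r' / k, s' / k, r, s)" k]) (auto simp: SL2_def k_def algebra_simps)
qed

lemma mapp_move1:
  obtains g where "g \<in> SL2" "mapp g (hom (x :: 'a option)) = (1, 0)"
proof -
  obtain y where "x \<noteq> y" by (metis option.distinct(1))
  then show ?thesis using mapp_move2 that by metis
qed

lemma act_cub: "act (g::'a mat2) (cub x) = tens (mapp g (hom x)) (mapp g (hom x))"
  by (simp add: cub_def act_tens)

lemma act_zero [simp]: "act (g::'a mat2) (v4 0 0 0 0) = v4 0 0 0 0"
  by (cases g) simp

lemma nz_iff: "(v::'a vec4) \<in> vecs \<Longrightarrow> nz v \<longleftrightarrow> v \<noteq> v4 0 0 0 0"
  by (metis nz_v4 v4_eq_iff vecs_eq_v4)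

lemma nz_act:
  assumes "(g::'a mat2) \<in> SL2" "v \<in> vecs" "nz v" shows "nz (act g v)"
  using assms act_minv(1)[OF assms(1,2)] nz_iff act_zero by (metis act_in_vecs)

lemma pact_in_PG3: "(g::'a mat2) \<in> SL2 \<Longrightarrow> P \<in> PG3 \<Longrightarrow> pact g P \<in> PG3"
  by (elim PG3E) (simp add: nz_act)

lemma pact_minv:
  assumes "(g::'a mat2) \<in> SL2" "P \<in> PG3"
  shows "pact (minv g) (pact g P) = P" "pact g (pact (minv g) P) = P"
  using assms by (auto simp: act_minv simp del: act.simps elim!: PG3E)

lemma pact_mmul: "P \<in> PG3 \<Longrightarrow> pact (g::'a mat2) (pact h P) = pact (mmul g h) P"
  by (elim PG3E) (simp add: act_mmul del: act.simps)

lemma inj_on_pact: "(g::'a mat2) \<in> SL2 \<Longrightarrow> inj_on (pact g) PG3"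
  by (metis inj_onI pact_minv(1))

lemma tcubic_subset_PG3: "tcubic \<subseteq> (PG3 :: 'a vec4 set set)"
  by (auto simp: tcubic_eq)

lemma tens_diag_in_tcubic:
  assumes "nz (tens p p)" shows "pt (tens p p) \<in> (tcubic :: 'a vec4 set set)"
proof -
  obtain s r where p: "p = (s, r)" by (cases p)
  show ?thesis
  proof (cases "r = 0")
    case True
    then have "tens p p = smul (s^3) (cub None)"
      by (simp add: p tens_def power2_eq_square power3_eq_cube)
    moreover have "s^3 \<noteq> 0" using assms True by (auto simp: p tens_def)
    ultimately show ?thesis by (auto simp: tcubic_eq simp del: smul_v4 cub_simps)
  next
    case False
    then have "tens p p = smul (r^3) (cub (Some (s / r)))"
      by (simp add: p tens_def power2_eq_square power3_eq_cube field_simps)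
    then show ?thesis using False by (auto simp: tcubic_eq simp del: smul_v4 cub_simps)
  qed
qed

lemma pact_tcubic: "(g::'a mat2) \<in> SL2 \<Longrightarrow> P \<in> tcubic \<Longrightarrow> pact g P \<in> tcubic"
  using nz_act[of g "cub _"] by (auto simp: tcubic_eq act_cub intro!: tens_diag_in_tcubic[unfolded tcubic_eq])

lemma pact_tcubic_iff:
  assumes "(g::'a mat2) \<in> SL2" "P \<in> PG3" shows "pact g P \<in> tcubic \<longleftrightarrow> P \<in> tcubic"
  using assms pact_tcubic minv_SL2 pact_minv(1) by metis

section \<open>Point and plane types\<close>

definition orth :: "'a vec4 set \<Rightarrow> 'a vec4 set \<Rightarrow> bool" where
  "orth P R \<longleftrightarrow> (\<forall>u\<in>P. \<forall>w\<in>R. bform u w = 0)"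

lemma orth_pt [simp]: "orth (pt u) (pt v) \<longleftrightarrow> bform u v = 0"
proof
  assume "bform u v = 0" then show "orth (pt u) (pt v)"
    by (auto simp: orth_def pt_conv_smul)
qed (simp add: orth_def)

lemma orth_commute: "orth P R \<longleftrightarrow> orth R P"
  by (metis orth_def bform_commute)

lemma orth_pact:
  assumes "g \<in> SL2" "P \<in> PG3" "R \<in> PG3" shows "orth (pact g P) (pact g R) \<longleftrightarrow> orth P R"
  using assms by (auto simp: bform_act simp del: act.simps bform_v4 elim!: PG3E)

lemma nroots_eq: "nroots v = card {R \<in> tcubic. orth (pt v) R}"
proof -
  have "{R \<in> tcubic. orth (pt v) R} = (\<lambda>x. pt (cub x)) ` {x. bform v (cub x) = 0}"
    by (auto simp: tcubic_eq)
  then show ?thesis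
    by (simp add: nroots_def card_image inj_on_subset[OF inj_pt_cub])
qed

lemma nroots_act:
  assumes "(g::'a mat2) \<in> SL2" "v \<in> vecs" "nz v" shows "nroots (act g v) = nroots v"
proof -
  \<comment> \<open>One inequality is enough: the inverse element gives the converse.\<close>
  have le: "nroots v \<le> nroots (act g v)" if "g \<in> SL2" "v \<in> vecs" "nz v" for g and v :: "'a vec4"
    unfolding nroots_eq
  proof (rule card_inj_on_le[where f = "pact g"])
    show "inj_on (pact g) {R \<in> tcubic. orth (pt v) R}"
      using inj_on_pact[OF that(1)] tcubic_subset_PG3 by (auto intro: inj_on_subset)
    show "finite {R \<in> tcubic. orth (pt (act g v)) R}"
      by (simp add: tcubic_eq)
    show "pact g ` {R \<in> tcubic. orth (pt v) R} \<subseteq> {R \<in> tcubic. orth (pt (act g v)) R}"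
      using that orth_pact[OF that(1), of "pt v"] tcubic_subset_PG3 pact_tcubic[OF that(1)] by auto
  qed
  show ?thesis
    using le[OF assms] le[OF minv_SL2, of g "act g v"] assms by (simp add: act_minv nz_act)
qed

lemma tens_singular [simp]: "qform (tens p q) = (0::'a)"
  by (simp add: tens_def algebra_simps)

text \<open>Vanishing \<open>qform\<close> says that the coordinates, read as a 2 x 2 matrix, have
  rank one. The double root enters the tensor squared, so recovering it takes a square root; the
  cases follow the last nonzero coordinates.\<close>

lemma singular_tensE:
  assumes "v \<in> vecs" "nz v" "qform v = (0::'a)"
  obtains k x y where "k \<noteq> 0" "v = smul k (tens (hom x) (hom y))"
proof -
  obtain a b c d where v: "v = v4 a b c d" using assms by (elim vecsE)
  then have q: "a * d = b * c" using assms by (simp add: add_eq_0_iff_eq)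
  show ?thesis
  proof (cases "d = 0")
    case False
    obtain t where t: "t^2 = b / d" using sqrt_exists by blast
    show ?thesis
      using False q t by (intro that[of d "Some t" "Some (c / d)"]) (auto simp: v tens_def field_simps)
  next
    case d: True
    show ?thesis
    proof (cases "b = 0")
      case False
      then show ?thesis using d q
        by (intro that[of b None "Some (a / b)"]) (auto simp: v tens_def)
    next
      case b: True
      show ?thesis
      proof (cases "c = 0")
        case False
        obtain t where t: "t^2 = a / c" using sqrt_exists by blast
        show ?thesis using d b t False
          by (intro that[of c "Some t" None]) (auto simp: v tens_def)
      next
        case True
        then show ?thesis using d b assms
          by (intro that[of a None None]) (auto simp: v tens_def)
      qed
    qed
  qed
qed

lemma det_hom_eq_0: "fst (hom x) * snd (hom y) + snd (hom x) * fst (hom y) = 0 \<longleftrightarrow> x = (y::'a option)"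
  by (cases x; cases y) (auto simp: add_eq_0_iff_eq)

text \<open>The pairing factors as [x,z]^2 [y,z], where [ , ] is the 2 x 2 determinant; this is the
  cubic with roots x, x, y.\<close>

lemma bform_tens_cub: "bform (tens (hom x) (hom y)) (cub z) = 0 \<longleftrightarrow> z = x \<or> z = (y::'a option)"
proof -
  have "bform (tens p q) (tens r r) =
      (fst p * snd r + snd p * fst r)^2 * (fst q * snd r + snd q * fst r)" for p q r :: "'a \<times> 'a"
    by (simp add: tens_def algebra_simps power2_eq_square)
  then show ?thesis by (auto simp: cub_def det_hom_eq_0)
qed

lemma nroots_tens: "nroots (tens (hom x) (hom y)) = card {x, y :: 'a option}"
proof -
  have "{z. z = x \<or> z = y} = {x, y}" by blast
  then show ?thesis by (simp add: nroots_def bform_tens_cub)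
qed

lemma pt_tens_eq_iff:
  "pt (tens (hom x) (hom y)) = pt (tens (hom x') (hom y')) \<longleftrightarrow> x = x' \<and> y = (y' :: 'a option)"
  by (cases x; cases y; cases x'; cases y') (auto simp: pt_eq_iff tens_def)

lemma tens_hom [simp]: "tens (hom x) (hom y) \<in> vecs" "nz (tens (hom x) (hom y))"
  by (simp add: tens_def) (cases x; cases y; simp add: tens_def)

lemma pt_tens_tcubic_iff: "pt (tens (hom x) (hom y)) \<in> tcubic \<longleftrightarrow> x = (y :: 'a option)"
  by (auto simp: tcubic_eq cub_def pt_tens_eq_iff)

text \<open>With 2 = 0 and 3 = 1 the second spanning vector of the tangent at t becomes (t^2, 0, 1,
  0), the tensor of t with infinity. The tangent at x is thus the ruling line of all tensors with
  first factor x, and these lines cover the quadric.\<close>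

lemma on_tangent_iff:
  assumes "v \<in> vecs" "nz v"
  shows "(\<exists>L\<in>tangents. pt v \<in> L) \<longleftrightarrow> qform v = (0::'a)"
proof
  assume "\<exists>L\<in>tangents. pt v \<in> L"
  then obtain u where "pt v = pt u" "qform u = 0"
    by (auto simp: tangents_def tangent_def line_of_def algebra_simps power2_eq_square power3_eq_cube)
  then show "qform v = 0" by (auto simp: pt_eq_iff)
next
  assume "qform v = 0"
  then obtain k x y where k: "k \<noteq> 0" "v = smul k (tens (hom x) (hom y))"
    using assms singular_tensE by metis
  have lineI: "pt (v4 (a * p + b * p') (a * q + b * q') (a * r + b * r') (a * s + b * s'))
      \<in> line_of (v4 p q r s) (v4 p' q' r' s')" if "a \<noteq> 0 \<or> b \<noteq> 0"
    for a b p q r s p' q' r' s' :: 'a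
    using that unfolding line_of_def by auto
  show "\<exists>L\<in>tangents. pt v \<in> L"
  proof (cases x)
    case None
    have "pt (tens (hom x) (hom y)) \<in> line_of (v4 1 0 0 0) (v4 0 1 0 0)"
      using lineI[of "fst (hom y)" "snd (hom y)" 1 0 0 1 0 0 0 0] None
      by (cases y) (auto simp: tens_def)
    then show ?thesis using k by (auto simp: tangents_def)
  next
    case (Some t)
    have "pt (tens (hom x) (hom y)) \<in> tangent t"
    proof (cases y)
      case None
      then show ?thesis using lineI[of 0 1 "t^3" "t^2" "t^2" 0 t 1 1 0] Some
        by (auto simp: tangent_def tens_def)
    next
      case (Some u)
      \<comment> \<open>The coefficients come from tens(t,u) = cub(t) + (u + t)(t^2, 0, 1,
        0).\<close>
      then show ?thesis using lineI[of 1 "u + t" "t^3" "t^2" "t^2" 0 t 1 1 0] \<open>x = Some t\<close>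
        by (auto simp: tangent_def tens_def algebra_simps power2_eq_square power3_eq_cube)
    qed
    then show ?thesis using k by (auto simp: tangents_def)
  qed
qed

text \<open>A cubic with roots x, x, y has a single root only if x = y, and then it is a cube, which
  is a point of the twisted cubic.\<close>

lemma tcubic_pt_iff:
  assumes "v \<in> vecs" "nz v"
  shows "pt v \<in> tcubic \<longleftrightarrow> qform v = (0::'a) \<and> nroots v = 1"
proof (cases "qform v = 0")
  case True
  then obtain k x y where k: "k \<noteq> 0" "v = smul k (tens (hom x) (hom y))"
    using assms singular_tensE by metis
  then show ?thesis by (simp add: pt_tens_tcubic_iff nroots_tens card_insert_if)
next
  case False
  have "pt v \<notin> tcubic"
  proof
    assume "pt v \<in> tcubic"
    then obtain x k where "v = smul k (cub x)" by (auto simp: tcubic_eq pt_eq_iff)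
    then show False using False by (simp add: cub_def)
  qed
  then show ?thesis using False by simp
qed

lemma nroots_singular:
  assumes "v \<in> vecs" "nz v" "qform v = (0::'a)" shows "nroots v \<in> {1, 2}"
proof -
  obtain k x y where "k \<noteq> 0" "v = smul k (tens (hom x) (hom y))"
    using assms by (rule singular_tensE)
  then show ?thesis by (simp add: nroots_tens card_insert_if)
qed

lemma T_point_pt_iff:
  assumes "v \<in> vecs" "nz v"
  shows "T_point (pt v) \<longleftrightarrow> qform v = (0::'a) \<and> nroots v = 2"
proof (cases "qform v = 0")
  case True
  then show ?thesis using nroots_singular[OF assms True] assms
    by (auto simp: T_point_def on_tangent_iff tcubic_pt_iff)
qed (use assms in \<open>simp add: T_point_def on_tangent_iff\<close>)

section \<open>The null polarity, \<open>\<Gamma>\<close>-planes and plane types\<close>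

definition polarp :: "'a vec4 set \<Rightarrow> 'a vec4 set set" where
  "polarp P = {R \<in> PG3. orth P R}"

lemma sum4: "(\<Sum>i<4. f i) = f (0::nat) + f 1 + f 2 + (f 3 :: 'a)"
  by (simp add: eval_nat_numeral)

lemma polarp_pt: "polarp (pt (v4 a b c d)) = plane (v4 d c b a)"
proof -
  have "R \<in> polarp (pt (v4 a b c d)) \<longleftrightarrow> R \<in> plane (v4 d c b a)" if PG3: "R \<in> PG3" for R
  proof -
    obtain p q r s where R: "R = pt (v4 p q r s)" "nz (v4 p q r s)" using PG3 by (elim PG3E)
    have "bform (v4 a b c d) w = (\<Sum>i<4. v4 d c b a i * w i)" for w
      unfolding sum4 by (simp add: bform_def algebra_simps)
    then have plane: "plane (v4 d c b a) = {pt w | w. w \<in> vecs \<and> nz w \<and> bform (v4 a b c d) w = 0}"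
      by (simp add: plane_def)
    have "R \<in> plane (v4 d c b a) \<longleftrightarrow> bform (v4 a b c d) (v4 p q r s) = 0"
      unfolding plane
    proof
      assume "R \<in> {pt w | w. w \<in> vecs \<and> nz w \<and> bform (v4 a b c d) w = 0}"
      then obtain w where "R = pt w" "bform (v4 a b c d) w = 0" by blast
      then show "bform (v4 a b c d) (v4 p q r s) = 0" using R(1) by (metis orth_pt)
    next
      assume "bform (v4 a b c d) (v4 p q r s) = 0"
      with R show "R \<in> {pt w | w. w \<in> vecs \<and> nz w \<and> bform (v4 a b c d) w = 0}"
        by (intro CollectI exI[of _ "v4 p q r s"] conjI v4_in_vecs)
    qed
    then show ?thesis using PG3 R by (simp add: polarp_def)
  qed
  moreover have "polarp (pt (v4 a b c d)) \<subseteq> PG3" "plane (v4 d c b a) \<subseteq> PG3"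
    by (auto simp: polarp_def plane_def)
  ultimately show ?thesis by blast
qed

lemma gamma_planes_eq: "gamma_planes = polarp ` tcubic"
proof -
  have "osc t = polarp (pt (cub (Some t)))" for t :: 'a
    by (simp add: osc_def polarp_pt)
  moreover have "plane (v4 0 0 0 1) = polarp (pt (cub None))"
    by (simp add: polarp_pt)
  ultimately show ?thesis
    by (auto simp: gamma_planes_def tcubic_def Pc_def Pinf_def image_Un image_image)
qed

lemma planes_eq: "planes = polarp ` (PG3 :: 'a vec4 set set)"
proof (intro equalityI subsetI)
  fix p :: "'a vec4 set set" assume "p \<in> planes"
  then obtain a b c d where "p = plane (v4 a b c d)" "nz (v4 a b c d)"
    unfolding planes_def by (auto elim!: vecsE)
  then show "p \<in> polarp ` PG3"
    by (intro image_eqI[of _ _ "pt (v4 d c b a)"]) (auto simp: polarp_pt)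
next
  fix p :: "'a vec4 set set" assume "p \<in> polarp ` PG3"
  then obtain a b c d where "p = plane (v4 d c b a)" "nz (v4 d c b a)"
    by (auto simp: polarp_pt elim!: PG3E)
  then show "p \<in> planes" unfolding planes_def by auto
qed

lemma inj_on_polarp: "inj_on polarp PG3"
proof (rule inj_onI)
  fix P R :: "'a vec4 set" assume PR: "P \<in> PG3" "R \<in> PG3" "polarp P = polarp R"
  obtain a b c d where P: "P = pt (v4 a b c d)" "nz (v4 a b c d)" using PR by (elim PG3E)
  obtain a' b' c' d' where R: "R = pt (v4 a' b' c' d')" "nz (v4 a' b' c' d')" using PR by (elim PG3E)
  have eq: "bform (v4 a' b' c' d') (v4 p q r s) = 0"
    if "bform (v4 a b c d) (v4 p q r s) = 0" for p q r s
  proof (cases "nz (v4 p q r s)")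
    case True
    then have "pt (v4 p q r s) \<in> polarp P" using that by (simp add: P polarp_def)
    then have "pt (v4 p q r s) \<in> polarp R" using PR by simp
    then show ?thesis by (simp add: R polarp_def)
  qed simp
  \<comment> \<open>Each test vector is visibly orthogonal to (a,b,c,d), since two equal terms
    cancel. Its pairing with (a',b',c',d') is a 2 x 2 minor of the two vectors, and all six minors
    vanish.\<close>
  have m: "a' * d = d' * a" "a' * b = b' * a" "a' * c = c' * a" "b' * c = c' * b" "b' * d = d' * b"
    "c' * d = d' * c"
    using eq[of a 0 0 d] eq[of 0 0 a b] eq[of 0 a 0 c] eq[of 0 b c 0] eq[of b 0 d 0] eq[of c d 0 0]
    by (simp_all add: add_eq_0_iff_eq mult.commute)
  consider "a \<noteq> 0" | "b \<noteq> 0" | "c \<noteq> 0" | "d \<noteq> 0" using P by auto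
  then have "\<exists>k. v4 a' b' c' d' = smul k (v4 a b c d)"
  proof cases
    case 1 then show ?thesis using m by (intro exI[of _ "a' / a"]) (simp add: field_simps)
  next
    case 2 then show ?thesis using m by (intro exI[of _ "b' / b"]) (simp add: field_simps)
  next
    case 3 then show ?thesis using m by (intro exI[of _ "c' / c"]) (simp add: field_simps)
  next
    case 4 then show ?thesis using m by (intro exI[of _ "d' / d"]) (simp add: field_simps)
  qed
  then obtain k where k: "v4 a' b' c' d' = smul k (v4 a b c d)" by blast
  then have "k \<noteq> 0" using R by auto
  then show "P = R" unfolding P(1) R(1) k by (rule pt_smul[symmetric])
qed

lemma polarp_in_gamma_iff: "P \<in> PG3 \<Longrightarrow> polarp P \<in> gamma_planes \<longleftrightarrow> P \<in> tcubic"
  unfolding gamma_planes_eq using inj_on_polarp tcubic_subset_PG3 by (metis inj_on_image_mem_iff)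

text \<open>A point lies on the polar plane of a cubic point exactly when that cubic point is
  orthogonal to it, so the \<open>\<Gamma>\<close>-planes through the point are indexed by the roots
  of its cubic.\<close>

lemma Gamma_point_pt_iff:
  assumes "v \<in> vecs" "nz v"
  shows "Gamma_point m (pt v) \<longleftrightarrow> qform v \<noteq> (0::'a) \<and> nroots v = m"
proof -
  have "{p \<in> gamma_planes. pt v \<in> p} = polarp ` {R \<in> tcubic. orth (pt v) R}"
    using assms orth_commute by (auto simp: gamma_planes_eq polarp_def)
  moreover have "inj_on polarp {R \<in> tcubic. orth (pt v) R}"
    using tcubic_subset_PG3 by (auto intro: inj_on_subset[OF inj_on_polarp])
  ultimately have "card {p \<in> gamma_planes. pt v \<in> p} = nroots v"
    by (simp add: card_image nroots_eq)
  then show ?thesis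
    using assms by (auto simp: Gamma_point_def tcubic_pt_iff T_point_def on_tangent_iff)
qed

text \<open>The dual reading: the cubic points in a plane are the roots of its pole, and the plane
  is a \<open>\<Gamma>\<close>-plane exactly when its pole lies on the cubic.\<close>

lemma C_plane_polarp_iff:
  assumes "P \<in> PG3"
  shows "C_plane d (polarp P) \<longleftrightarrow> P \<notin> tcubic \<and> card {R \<in> tcubic. orth P R} = d"
proof -
  have "polarp P \<inter> tcubic = {R \<in> tcubic. orth P R}"
    using tcubic_subset_PG3 by (auto simp: polarp_def)
  then show ?thesis
    using assms by (simp add: C_plane_def planes_eq polarp_in_gamma_iff)
qed

lemma C_plane_pt_iff:
  assumes "v \<in> vecs" "nz v"
  shows "C_plane d (polarp (pt v)) \<longleftrightarrow> \<not> (qform v = 0 \<and> nroots v = 1) \<and> nroots v = d"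
  using assms by (simp add: C_plane_polarp_iff tcubic_pt_iff nroots_eq)


section \<open>The group of the twisted cubic\<close>

lemma poly_vanish_imp_0:
  assumes "\<And>t::'a. poly p t = 0" "degree p < card (UNIV :: 'a set)"
  shows "p = 0"
  using card_poly_roots_bound[of p] assms by fastforce

lemma coeffs_vanish:
  fixes c0 c1 c2 c3 c4 c5 c6 :: 'a
  assumes "card (UNIV :: 'a set) \<ge> 8"
    "\<And>t. c0 + c1 * t + c2 * t^2 + c3 * t^3 + c4 * t^4 + c5 * t^5 + c6 * t^6 = 0"
  shows "c0 = 0 \<and> c1 = 0 \<and> c2 = 0 \<and> c3 = 0 \<and> c4 = 0 \<and> c5 = 0 \<and> c6 = 0"
proof -
  let ?p = "[:c0, c1, c2, c3, c4, c5, c6:]"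
  have "?p = 0"
  proof (rule poly_vanish_imp_0)
    show "poly ?p t = 0" for t
      using assms(2)[of t] by (simp add: algebra_simps eval_nat_numeral)
    show "degree ?p < card (UNIV :: 'a set)"
      using assms(1) by (intro le_less_trans[OF degree_le[of 6]]) (auto simp: coeff_pCons split: nat.splits)
  qed
  then show ?thesis by simp
qed

lemma mapv_eq: "mapv M v = v4 (\<Sum>j<4. M 0 j * v j) (\<Sum>j<4. M 1 j * v j)
    (\<Sum>j<4. M 2 j * v j) (\<Sum>j<4. M 3 j * (v j :: 'a))"
  by (subst vecs_eq_v4) (auto simp: mapv_def vecs_def)

lemma mapv_smul: "mapv M (smul k v) = smul k (mapv M (v :: 'a vec4))"
  by (simp add: mapv_eq sum4 algebra_simps)

lemma actP_pt: "actP M (pt v) = pt (mapv M (v :: 'a vec4))"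
  unfolding actP_def pt_conv_smul by (auto simp: image_iff mapv_smul) (metis mapv_smul)

fun act_matrix :: "'a mat2 \<Rightarrow> nat \<Rightarrow> nat \<Rightarrow> 'a" where
  "act_matrix (a, b, c, d) i j = v4
     (v4 (a^3) (a^2 * b) (a * b^2) (b^3) j)
     (v4 (a^2 * c) (a^2 * d) (b^2 * c) (b^2 * d) j)
     (v4 (a * c^2) (b * c^2) (a * d^2) (b * d^2) j)
     (v4 (c^3) (c^2 * d) (c * d^2) (d^3) j) i"

lemma mapv_act_matrix: "mapv (act_matrix g) v = act g v"
  by (cases g) (simp add: mapv_eq sum4)

lemma act_matrix_in_Gq:
  assumes "g \<in> SL2" shows "act_matrix g \<in> Gq"
proof -
  have "invertible4 (act_matrix g)"
    unfolding invertible4_def mapv_act_matrix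
    by (rule exI[of _ "act_matrix (minv g)"]) (simp add: mapv_act_matrix act_minv[OF assms])
  moreover have "actS (act_matrix g) tcubic = tcubic"
  proof -
    have "actS (act_matrix g) tcubic = pact g ` tcubic"
      by (simp add: actS_def actP_def pact_def mapv_act_matrix)
    also have "\<dots> = tcubic"
    proof
      show "pact g ` tcubic \<subseteq> tcubic" using pact_tcubic[OF assms] by blast
      show "tcubic \<subseteq> pact g ` tcubic"
      proof
        fix P :: "'a vec4 set" assume P: "P \<in> tcubic"
        then have "P = pact g (pact (minv g) P)"
          using pact_minv(2)[OF assms] tcubic_subset_PG3 by auto
        then show "P \<in> pact g ` tcubic"
          using pact_tcubic[OF minv_SL2[OF assms] P] by blast
      qed
    qed
    finally show ?thesis .
  qed
  ultimately show ?thesis by (simp add: Gq_def)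
qed

text \<open>These are the three quadrics through the twisted cubic. Substituting a transformed
  parametrization turns them into polynomial identities in t.\<close>

lemma tcubic_relations:
  assumes "pt (v4 a b c d) \<in> (tcubic :: 'a vec4 set set)"
  shows "b^2 = a * c" "c^2 = b * d" "a * d = b * c"
proof -
  obtain k x where "v4 a b c d = smul k (cub x)"
    using assms by (auto simp: tcubic_eq pt_eq_iff)
  then show "b^2 = a * c" "c^2 = b * d" "a * d = b * c"
    by (cases x; simp add: power2_eq_square power3_eq_cube algebra_simps)+
qed

text \<open>After composition with a suitable element of \<open>SL2\<close> the map fixes the points
  at infinity and at zero. The quadrics through the cubic then force it to be diagonal with entries
  proportional to e^6, e^4, e^2, 1, which is the diagonal element (e, 0, 0, 1/e) up to a
  scalar.\<close>

lemma Gq_is_act: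
  assumes card: "card (UNIV :: 'a set) \<ge> 8" and M: "M \<in> (Gq :: (nat \<Rightarrow> nat \<Rightarrow> 'a) set)"
  obtains g k where "g \<in> SL2" "k \<noteq> 0" "\<And>v. v \<in> vecs \<Longrightarrow> mapv M v = smul k (act g v)"
proof -
  have inC: "pt (mapv M (cub x)) \<in> tcubic" for x
  proof -
    have "actP M (pt (cub x)) \<in> actS M tcubic" by (auto simp: actS_def tcubic_eq)
    then show ?thesis using M by (simp add: Gq_def actP_pt)
  qed
  obtain N where N: "\<And>v. v \<in> vecs \<Longrightarrow> mapv N (mapv M v) = v"
    using M by (auto simp: Gq_def invertible4_def)
  obtain x where x: "pt (mapv M (cub None)) = pt (cub x)" using inC[of None] by (auto simp: tcubic_eq)
  obtain y where y: "pt (mapv M (cub (Some 0))) = pt (cub y)" using inC[of "Some 0"] by (auto simp: tcubic_eq)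
  have "x \<noteq> y"
  proof
    assume "x = y"
    then have "actP N (pt (mapv M (cub None))) = actP N (pt (mapv M (cub (Some 0))))"
      using x y by simp
    then have "pt (cub None) = pt (cub (Some (0::'a)))"
      unfolding actP_pt using N cub_in_vecs by metis
    then show False using inj_pt_cub by (metis injD option.distinct(1))
  qed
  then obtain g k where g: "g \<in> SL2" "k \<noteq> 0" "mapp g (hom x) = (1, 0)" "mapp g (hom y) = (0, k)"
    by (rule mapp_move2)
  \<comment> \<open>\<open>g\<close> moves the images of infinity and zero back, so \<open>W\<close>
    fixes both points; only its two middle columns remain unknown.\<close>
  define W where "W v = act g (mapv M v)" for v
  have WC: "pt (W (cub z)) \<in> tcubic" for z
    unfolding W_def using pact_tcubic[OF g(1) inC[of z]] by simp
  have W_lin: "W (v4 p q r s) = v4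
      (p * W (v4 1 0 0 0) 0 + q * W (v4 0 1 0 0) 0 + r * W (v4 0 0 1 0) 0 + s * W (v4 0 0 0 1) 0)
      (p * W (v4 1 0 0 0) 1 + q * W (v4 0 1 0 0) 1 + r * W (v4 0 0 1 0) 1 + s * W (v4 0 0 0 1) 1)
      (p * W (v4 1 0 0 0) 2 + q * W (v4 0 1 0 0) 2 + r * W (v4 0 0 1 0) 2 + s * W (v4 0 0 0 1) 2)
      (p * W (v4 1 0 0 0) 3 + q * W (v4 0 1 0 0) 3 + r * W (v4 0 0 1 0) 3 + s * W (v4 0 0 0 1) 3)"
    for p q r s
    unfolding W_def by (cases g) (simp add: mapv_eq sum4 algebra_simps)
  have "pt (W (cub None)) = pt (act g (cub x))"
    unfolding W_def using x by (metis pact_pt)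
  then have "pt (W (v4 1 0 0 0)) = pt (v4 1 0 0 0)"
    by (simp add: act_cub g tens_def del: act.simps)
  then obtain k0 where k0: "k0 \<noteq> 0" "W (v4 1 0 0 0) = v4 k0 0 0 0" by (auto simp: pt_eq_iff)
  have "pt (W (cub (Some 0))) = pt (act g (cub y))"
    unfolding W_def using y by (metis pact_pt)
  then have "pt (W (v4 0 0 0 1)) = pt (v4 0 0 0 (k^3))"
    by (simp add: act_cub g tens_def power2_eq_square power3_eq_cube mult.assoc del: act.simps)
  then obtain l where "l \<noteq> 0" "W (v4 0 0 0 1) = v4 0 0 0 (l * k^3)" by (auto simp: pt_eq_iff)
  then obtain k3 where k3: "k3 \<noteq> 0" "W (v4 0 0 0 1) = v4 0 0 0 k3"
    using g(2) by (intro that[of "l * k^3"]) auto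
  obtain n01 n11 n21 n31 where n1: "W (v4 0 1 0 0) = v4 n01 n11 n21 n31"
    unfolding W_def using act_in_vecs by (metis vecsE)
  obtain n02 n12 n22 n32 where n2: "W (v4 0 0 1 0) = v4 n02 n12 n22 n32"
    unfolding W_def using act_in_vecs by (metis vecsE)
  have W: "W (v4 p q r s) = v4 (p * k0 + q * n01 + r * n02) (q * n11 + r * n12)
      (q * n21 + r * n22) (q * n31 + r * n32 + s * k3)" for p q r s
    by (subst W_lin) (simp add: k0 k3 n1 n2)
  \<comment> \<open>The three quadric equations at W(cub t), each a polynomial in t of degree at
    most 6. Their coefficients give \<open>r1\<close>, \<open>r2\<close> and
    \<open>r3\<close>.\<close>
  have rel: "(t^2 * n11 + t * n12)^2 + (t^3 * k0 + t^2 * n01 + t * n02) * (t^2 * n21 + t * n22) = 0"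
    "(t^2 * n21 + t * n22)^2 + (t^2 * n11 + t * n12) * (t^2 * n31 + t * n32 + k3) = 0"
    "(t^3 * k0 + t^2 * n01 + t * n02) * (t^2 * n31 + t * n32 + k3)
      + (t^2 * n11 + t * n12) * (t^2 * n21 + t * n22) = 0" for t
    using tcubic_relations[of "t^3 * k0 + t^2 * n01 + t * n02" "t^2 * n11 + t * n12"
      "t^2 * n21 + t * n22" "t^2 * n31 + t * n32 + k3"] WC[of "Some t"]
    by (simp_all add: W add_eq_0_iff_eq)
  have pw: "t^2 = t * t" "t^3 = t * (t * t)" "t^4 = t * (t * (t * t))" "t^5 = t * (t * (t * (t * t)))"
    "t^6 = t * (t * (t * (t * (t * t))))"
    for t :: 'a by (simp_all add: eval_nat_numeral)
  have r1: "n11^2 + k0 * n22 + n01 * n21 = 0 \<and> k0 * n21 = 0"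
    using coeffs_vanish[OF card, of 0 0 "n12^2 + n02 * n22" "n01 * n22 + n02 * n21"
      "n11^2 + k0 * n22 + n01 * n21" "k0 * n21" 0] rel(1)
    by (simp add: pw algebra_simps)
  have r2: "n12 * k3 = 0 \<and> n22^2 + n11 * k3 + n12 * n32 = 0"
    using coeffs_vanish[OF card, of 0 "n12 * k3" "n22^2 + n11 * k3 + n12 * n32"
      "n11 * n32 + n12 * n31" "n21^2 + n11 * n31" 0 0] rel(2)
    by (simp add: pw algebra_simps)
  have r3: "n02 * k3 = 0 \<and> n01 * k3 + n02 * n32 + n12 * n22 = 0
     \<and> k0 * k3 + n01 * n32 + n02 * n31 + n11 * n22 + n12 * n21 = 0
     \<and> k0 * n32 + n01 * n31 + n11 * n21 = 0 \<and> k0 * n31 = 0"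
    using coeffs_vanish[OF card, of 0 "n02 * k3" "n01 * k3 + n02 * n32 + n12 * n22"
      "k0 * k3 + n01 * n32 + n02 * n31 + n11 * n22 + n12 * n21"
      "k0 * n32 + n01 * n31 + n11 * n21" "k0 * n31" 0] rel(3)
    by (simp add: pw algebra_simps)
  have n0: "n21 = 0" "n12 = 0" "n31 = 0" "n02 = 0" "n32 = 0" "n01 = 0"
    using r1 r2 r3 k0(1) k3(1) by auto
  have n: "k0 * k3 = n11 * n22" "n22^2 = n11 * k3"
    using r2 r3 by (simp_all add: n0 add_eq_0_iff_eq)
  have n22: "n22 \<noteq> 0" using n k0 k3 by auto
  \<comment> \<open>The wanted diagonal entries satisfy n22 / k3 = e^2; a square root therefore
    recovers the group element, and the two relations in \<open>n\<close> determine the other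
    entries.\<close>
  obtain e where e: "e^2 = n22 / k3" using sqrt_exists by blast
  have e0: "e \<noteq> 0" using e n22 k3 by auto
  have v22: "n22 = k3 * e^2" using e k3 by simp
  have "k3 * n11 = k3 * (k3 * e^4)"
    using n(2)[symmetric] by (simp add: v22 power2_eq_square eval_nat_numeral algebra_simps)
  then have v11: "n11 = k3 * e^4" using k3 by simp
  have "k3 * k0 = k3 * (k3 * e^6)"
    using n(1) by (simp add: v22 v11 eval_nat_numeral algebra_simps)
  then have v0: "k0 = k3 * e^6" using k3 by simp
  define h :: "'a mat2" where "h = (e, 0, 0, 1 / e)"
  have h: "h \<in> SL2" using e0 by (simp add: SL2_def h_def)
  have Wh: "W v = smul (k3 * e^3) (act h v)" if v: "v \<in> vecs" for v
  proof -
    obtain p q r s where "v = v4 p q r s" using v by (rule vecsE)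
    then show ?thesis
      using e0 by (simp add: W h_def n0 v22 v11 v0 pw field_simps)
  qed
  show ?thesis
  proof (rule that)
    show "mmul (minv g) h \<in> SL2" using g(1) h by (simp add: mmul_SL2 minv_SL2)
    show "k3 * e^3 \<noteq> 0" using k3 e0 by simp
    fix v :: "'a vec4" assume v: "v \<in> vecs"
    have "mapv M v \<in> vecs" by (simp add: mapv_eq)
    then have "mapv M v = act (minv g) (W v)" by (simp add: W_def act_minv g(1) del: act.simps)
    then show "mapv M v = smul (k3 * e^3) (act (mmul (minv g) h) v)"
      by (simp add: Wh v act_mmul del: act.simps)
  qed
qed

lemma line_orbit_eq:
  assumes card: "card (UNIV :: 'a set) \<ge> 8" and L: "L \<subseteq> (PG3 :: 'a vec4 set set)"
  shows "line_orbit L = (\<lambda>g. sact g L) ` SL2"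
proof
  show "line_orbit L \<subseteq> (\<lambda>g. sact g L) ` SL2"
  proof
    fix l assume "l \<in> line_orbit L"
    then obtain M where M: "M \<in> Gq" "l = actS M L" by (auto simp: line_orbit_def)
    obtain g k where g: "g \<in> SL2" "k \<noteq> 0" "\<And>v. v \<in> vecs \<Longrightarrow> mapv M v = smul k (act g v)"
      using Gq_is_act[OF card M(1)] by metis
    have "actP M P = pact g P" if "P \<in> L" for P
    proof -
      from that L have "P \<in> PG3" by blast
      then obtain p q r s where "P = pt (v4 p q r s)" by (rule PG3E)
      then show ?thesis using g by (simp add: actP_pt del: act.simps)
    qed
    then have "l = sact g L" using M by (auto simp: actS_def sact_def)
    then show "l \<in> (\<lambda>g. sact g L) ` SL2" using g by blast
  qed
  show "(\<lambda>g. sact g L) ` SL2 \<subseteq> line_orbit L"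
  proof clarify
    fix a b c d :: 'a assume "(a, b, c, d) \<in> SL2"
    then have "act_matrix (a, b, c, d) \<in> Gq" by (rule act_matrix_in_Gq)
    moreover have "sact (a, b, c, d) L = actS (act_matrix (a, b, c, d)) L"
      by (simp add: actS_def actP_def sact_def pact_def mapv_act_matrix[abs_def])
    ultimately show "sact (a, b, c, d) L \<in> line_orbit L" by (auto simp: line_orbit_def)
  qed
qed


section \<open>Counting cubics by their number of roots\<close>

lemma mult_eq_1D: "b * c = 1 \<Longrightarrow> b \<noteq> 0 \<and> c = 1 / (b::'a)"
  by (metis mult_zero_left nonzero_mult_div_cancel_left zero_neq_one)

lemma mmul_assoc: "mmul (mmul g h) k = mmul g (mmul h (k::'a mat2))"
  by (cases g; cases h; cases k) (simp add: algebra_simps)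

lemma mmul_one: "mmul (1, 0, 0, 1) g = (g::'a mat2)"
  by (cases g) simp

lemma mmul_minv_cancel:
  assumes "(g::'a mat2) \<in> SL2" shows "mmul g (mmul (minv g) h) = h"
  using assms by (simp add: mmul_minv mmul_one flip: mmul_assoc)

lemma minv_minv [simp]: "minv (minv g) = g"
  by (cases g) simp

lemma minv_mmul_cancel:
  assumes "(g::'a mat2) \<in> SL2" shows "mmul (minv g) (mmul g h) = h"
  using mmul_minv_cancel[OF minv_SL2[OF assms]] by simp

lemma card_SL2: "card (SL2 :: 'a mat2 set) = card (UNIV::'a set) * (card (UNIV::'a set) - 1) * (card (UNIV::'a set) + 1)"
proof -
  let ?q = "card (UNIV :: 'a set)"
  \<comment> \<open>If d is nonzero, then b, c, d are free and determine a; if d = 0, then c = 1/b.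
    These are the sets \<open>A\<close> and \<open>B\<close>.\<close>
  define A :: "'a mat2 set" where "A = (\<lambda>(b, c, d). ((1 + b * c) / d, b, c, d)) ` (UNIV \<times> UNIV \<times> (UNIV - {0::'a}))"
  define B :: "'a mat2 set" where "B = (\<lambda>(a, b). (a, b, 1 / b, 0)) ` (UNIV \<times> (UNIV - {0::'a}))"
  have "SL2 = A \<union> B"
  proof (intro equalityI subsetI)
    fix g :: "'a mat2" assume g: "g \<in> SL2"
    obtain a b c d where abcd: "g = (a, b, c, d)" by (cases g)
    with g have det: "a * d + b * c = 1" by (simp add: SL2_def)
    show "g \<in> A \<union> B"
    proof (cases "d = 0")
      case True
      then have "b \<noteq> 0" "c = 1 / b" using det mult_eq_1D[of b c] by auto
      then show ?thesis using True abcd by (auto simp: B_def image_iff)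
    next
      case False
      have "a * d = 1 + b * c" using det by (metis add_self_left add.commute)
      then have "a = (1 + b * c) / d" using False by (simp add: field_simps)
      then show ?thesis using False abcd by (auto simp: A_def image_iff)
    qed
  next
    fix g assume "g \<in> A \<union> B"
    then show "g \<in> SL2" by (auto simp: A_def B_def SL2_def add.assoc split: if_splits)
  qed
  moreover have "A \<inter> B = {}" by (auto simp: A_def B_def)
  moreover have "card A = ?q * (?q * (?q - 1))"
    unfolding A_def by (subst card_image) (auto simp: inj_on_def card_cartesian_product card_Diff_singleton)
  moreover have "card B = ?q * (?q - 1)"
    unfolding B_def by (subst card_image) (auto simp: inj_on_def card_cartesian_product card_Diff_singleton)
  moreover have "finite A" "finite B" by (simp_all add: A_def B_def)
  ultimately have "card (SL2 :: 'a mat2 set) = ?q * (?q * (?q - 1)) + ?q * (?q - 1)"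
    using card_Un_disjoint[of A B] by simp
  then show ?thesis by (simp add: algebra_simps)
qed

text \<open>Canonical representatives of the points off the quadric: scaling by k multiplies
  \<open>qform\<close> by k^2, and k^2 takes every nonzero value exactly once.\<close>

definition unimod :: "'a vec4 set" where
  "unimod = {v \<in> vecs. qform v = 1}"

lemma finite_unimod: "finite unimod"
  using finite_vecs by (auto simp: unimod_def)

lemma unimod_vecs: "v \<in> unimod \<Longrightarrow> v \<in> vecs"
  by (simp add: unimod_def)

lemma unimodE:
  assumes "v \<in> unimod" obtains a b c d where "v = v4 a b c d" "a * d + b * c = 1"
  using assms vecsE[of v] unfolding unimod_def by (metis (mono_tags) mem_Collect_eq qform_v4)

lemma unimod_nz: "v \<in> unimod \<Longrightarrow> nz v"
proof (rule ccontr)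
  assume v: "v \<in> unimod" "\<not> nz v"
  then have "v = v4 0 0 0 0" using nz_iff unimod_vecs by blast
  then have "qform v = 0" by simp
  then show False using v by (simp add: unimod_def)
qed

text \<open>The condition a d + b c = 1 is the defining equation of \<open>SL2\<close>, so the two
  sets coincide up to packaging of the coordinates.\<close>

lemma card_unimod: "card unimod = card (SL2 :: 'a mat2 set)"
proof -
  have "unimod = (\<lambda>(a, b, c, d). v4 a b c d) ` SL2"
  proof (intro equalityI subsetI)
    fix v assume "v \<in> unimod"
    then obtain a b c d where "v = v4 a b c d" "a * d + b * c = 1" by (rule unimodE)
    then show "v \<in> (\<lambda>(a, b, c, d). v4 a b c d) ` SL2"
      by (intro image_eqI[of _ _ "(a, b, c, d)"]) (auto simp: unimod_def SL2_def)
  qed (auto simp: unimod_def SL2_def)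
  moreover have "inj_on (\<lambda>(a, b, c, d). v4 a b c d) (SL2 :: 'a mat2 set)"
    by (auto simp: inj_on_def)
  ultimately show ?thesis by (metis card_image)
qed

lemma act_unimod: "g \<in> SL2 \<Longrightarrow> v \<in> unimod \<Longrightarrow> act g v \<in> unimod"
  by (simp add: unimod_def qform_act)

lemma card_unimod_act:
  assumes "g \<in> SL2" shows "card {v \<in> unimod. P (act g v)} = card {v \<in> unimod. P v}"
proof (rule bij_betw_same_card[of "act g"])
  show "bij_betw (act g) {v \<in> unimod. P (act g v)} {v \<in> unimod. P v}"
    by (rule bij_betw_byWitness[where f' = "act (minv g)"])
      (use assms in \<open>auto simp: unimod_vecs act_minv act_unimod minv_SL2 simp del: act.simps minv.simps\<close>)
qed

text \<open>Move the root to infinity: the leading coefficient vanishes, which leaves b c = 1 with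
  the constant term a free.\<close>

lemma card_unimod_root:
  "card {v \<in> unimod. bform v (cub x) = 0} = card (UNIV::'a set) * (card (UNIV::'a set) - 1)"
proof -
  obtain g where g: "g \<in> SL2" "mapp g (hom x) = (1, 0)" by (rule mapp_move1)
  have "bform v (cub x) = (act g v) 3" if "v \<in> unimod" for v
  proof -
    have "bform v (cub x) = bform (act g v) (act g (cub x))"
      using g that by (simp add: bform_act unimod_vecs)
    then show ?thesis unfolding act_cub g by (simp add: tens_def bform_def)
  qed
  then have "card {v \<in> unimod. bform v (cub x) = 0} = card {v \<in> unimod. (act g v) 3 = 0}"
    by (intro arg_cong[where f = card] Collect_cong) (simp del: act.simps cub_simps cong: conj_cong)
  also have "\<dots> = card {v \<in> unimod. v 3 = 0}"
    by (rule card_unimod_act[OF g(1)])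
  also have "{v \<in> unimod. v 3 = 0} = (\<lambda>(a, b). v4 a b (1 / b) 0) ` (UNIV \<times> (UNIV - {0}))"
  proof (intro equalityI subsetI)
    fix v assume v: "v \<in> {v \<in> unimod. v 3 = 0}"
    then have "v \<in> unimod" by simp
    then obtain a b c d where "v = v4 a b c d" "a * d + b * c = 1" by (rule unimodE)
    with v show "v \<in> (\<lambda>(a, b). v4 a b (1 / b) 0) ` (UNIV \<times> (UNIV - {0}))"
      by (intro image_eqI[of _ _ "(a, b)"]) (auto simp: unimod_def dest: mult_eq_1D)
  qed (auto simp: unimod_def)
  also have "card \<dots> = card (UNIV::'a set) * (card (UNIV::'a set) - 1)"
    by (subst card_image) (auto simp: inj_on_def card_cartesian_product card_Diff_singleton)
  finally show ?thesis .
qed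

text \<open>Move the roots to infinity and zero: both extreme coefficients vanish, and only b c = 1
  is left.\<close>

lemma card_unimod_root2:
  assumes "x \<noteq> y"
  shows "card {v \<in> unimod. bform v (cub x) = 0 \<and> bform v (cub y) = 0} = card (UNIV::'a set) - 1"
proof -
  obtain g k where g: "g \<in> SL2" "k \<noteq> 0" "mapp g (hom x) = (1, 0)" "mapp g (hom y) = (0, k)"
    using assms by (rule mapp_move2)
  have "bform v (cub x) = 0 \<and> bform v (cub y) = 0 \<longleftrightarrow> (act g v) 3 = 0 \<and> (act g v) 0 = 0"
    if "v \<in> unimod" for v
  proof -
    have "bform v (cub x) = bform (act g v) (act g (cub x))"
      "bform v (cub y) = bform (act g v) (act g (cub y))"
      using g that by (simp_all add: bform_act unimod_vecs)
    then show ?thesis unfolding act_cub g using g(2) by (simp add: tens_def bform_def)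
  qed
  then have "card {v \<in> unimod. bform v (cub x) = 0 \<and> bform v (cub y) = 0}
      = card {v \<in> unimod. (act g v) 3 = 0 \<and> (act g v) 0 = 0}"
    by (intro arg_cong[where f = card] Collect_cong) (simp del: act.simps cub_simps cong: conj_cong)
  also have "\<dots> = card {v \<in> unimod. v 3 = 0 \<and> v 0 = 0}"
    by (rule card_unimod_act[OF g(1)])
  also have "{v \<in> unimod. v 3 = 0 \<and> v 0 = 0} = (\<lambda>b. v4 0 b (1 / b) 0) ` (UNIV - {0})"
  proof (intro equalityI subsetI)
    fix v assume v: "v \<in> {v \<in> unimod. v 3 = 0 \<and> v 0 = 0}"
    then have "v \<in> unimod" by simp
    then obtain a b c d where "v = v4 a b c d" "a * d + b * c = 1" by (rule unimodE)
    with v show "v \<in> (\<lambda>b. v4 0 b (1 / b) 0) ` (UNIV - {0})"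
      by (intro image_eqI[of _ _ b]) (auto simp: unimod_def dest: mult_eq_1D)
  qed (auto simp: unimod_def)
  also have "card \<dots> = card (UNIV::'a set) - 1"
    by (subst card_image) (auto simp: inj_on_def card_Diff_singleton)
  finally show ?thesis .
qed

lemma card_option: "card (UNIV :: 'a option set) = card (UNIV :: 'a set) + 1"
  by (simp add: UNIV_option_conv card_image)

lemma card_offdiag:
  assumes "finite A" shows "card {(x, y). x \<in> A \<and> y \<in> A \<and> x \<noteq> y} = card A * (card A - 1)"
proof -
  have "{(x, y). x \<in> A \<and> y \<in> A \<and> x \<noteq> y} = A \<times> A - (\<lambda>x. (x, x)) ` A" by auto
  then have "card {(x, y). x \<in> A \<and> y \<in> A \<and> x \<noteq> y} = card (A \<times> A) - card ((\<lambda>x. (x, x)) ` A)"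
    using assms by (simp add: card_Diff_subset image_subset_iff)
  then show ?thesis by (simp add: card_image inj_on_def card_cartesian_product diff_mult_distrib2)
qed

text \<open>With a root at infinity the cubic is a + b t + c t^2 with b c = 1, and a diagonal
  element scales b and c to 1. The result is an Artin-Schreier polynomial t^2 + t + a.\<close>

lemma unimod_move_rootE:
  assumes "v \<in> unimod" "bform v (cub x) = 0"
  obtains g a where "g \<in> SL2" "act g v = v4 a 1 1 0"
proof -
  obtain h where h: "h \<in> SL2" "mapp h (hom x) = (1, 0)" by (rule mapp_move1)
  obtain a b c d where w: "act h v = v4 a b c d" using act_in_vecs vecsE by metis
  have "bform (act h v) (act h (cub x)) = 0" using assms h by (simp add: bform_act unimod_vecs)
  then have "d = 0" unfolding act_cub h w by (simp add: tens_def)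
  moreover have "act h v \<in> unimod" using act_unimod assms h by blast
  ultimately have bc: "b * c = 1" unfolding w by (simp add: unimod_def)
  then have "b \<noteq> 0" by auto
  then have "act (1 / b, 0, 0, b) (act h v) = v4 (a / b^3) 1 1 0"
    using bc \<open>d = 0\<close> by (simp add: w field_simps power2_eq_square power3_eq_cube)
  moreover have "(1 / b, 0, 0, b) \<in> SL2" using \<open>b \<noteq> 0\<close> by (simp add: SL2_def)
  ultimately show ?thesis
    using that[of "mmul (1 / b, 0, 0, b) h" "a / b^3"] h(1) mmul_SL2 unfolding act_mmul by blast
qed

lemma bform_cub_simps [simp]:
  "bform (v4 a b c d) (cub None) = d"
  "bform (v4 a b c d) (cub (Some t)) = a + d * t^3 + b * t + c * (t::'a)^2"
  by simp_all

lemma nroots_v4: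
  "nroots (v4 a b c (d::'a)) = card {t. a + d * t^3 + b * t + c * t^2 = 0} + (if d = 0 then 1 else 0)"
proof -
  let ?S = "{t. a + d * t^3 + b * t + c * t^2 = 0}"
  have "{x. bform (v4 a b c d) (cub x) = 0} = Some ` ?S \<union> (if d = 0 then {None} else {})"
    (is "?L = ?R")
  proof (rule set_eqI)
    fix x show "x \<in> ?L \<longleftrightarrow> x \<in> ?R" by (cases x) auto
  qed
  then show ?thesis by (simp add: nroots_def card_image card_insert_if image_iff del: cub_simps bform_v4)
qed

text \<open>The roots of t^2 + t + a come in pairs t, t + 1. Together with infinity there are one or
  three roots, never two.\<close>

lemma nroots_unimod:
  assumes "v \<in> unimod" shows "nroots v \<in> {0, 1, 3}"
proof (cases "nroots v = 0")
  case False
  then have "{x. bform v (cub x) = 0} \<noteq> {}" unfolding nroots_def by (metis card.empty)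
  then obtain x where "bform v (cub x) = 0" by blast
  then obtain g a where g: "g \<in> SL2" "act g v = v4 a 1 1 0"
    using unimod_move_rootE assms by blast
  then have "nroots v = nroots (v4 a 1 1 0)" using nroots_act assms by (metis unimod_nz unimod_vecs)
  also have "\<dots> \<in> {1, 3}"
  proof (cases "\<exists>t. a + t + t^2 = 0")
    case True
    then obtain t where t: "a = t + t^2" by (metis add.assoc add_eq_0_iff_eq)
    have "a + s + s^2 = (s + t) * (s + (t + 1))" for s
      unfolding t by (simp add: algebra_simps power2_eq_square)
    then have "{s. a + s + s^2 = 0} = {t, t + 1}" by (auto simp: add_eq_0_iff_eq)
    then show ?thesis by (simp add: nroots_v4)
  qed (simp add: nroots_v4)
  finally show ?thesis by blast
qed simp

lemma nonsingular_scale: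
  assumes "v \<in> vecs" "qform v \<noteq> (0::'a)"
  obtains k where "k \<noteq> 0" "smul k v \<in> unimod"
proof -
  obtain k where k: "k^2 = 1 / qform v" using sqrt_exists by blast
  have "k \<noteq> 0" using k assms by auto
  moreover have "smul k v \<in> unimod" using k assms by (auto simp: unimod_def vecs_def)
  ultimately show ?thesis using that by blast
qed

lemma nroots_nonsingular:
  assumes "v \<in> vecs" "qform v \<noteq> (0::'a)" shows "nroots v \<in> {0, 1, 3}"
proof -
  obtain k where "k \<noteq> 0" "smul k v \<in> unimod" using assms by (rule nonsingular_scale)
  then show ?thesis using nroots_unimod[of "smul k v"] by simp
qed

text \<open>The three counts are determined by the total number of vectors, the number of pairs
  (cubic, root), and the number of triples (cubic, ordered pair of distinct roots). All three
  quantities equal |SL(2,q)|, which gives n0 + n1 + n3 = n1 + 3 n3 = 6 n3.\<close>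

lemma card_unimod_types:
  defines "n \<equiv> \<lambda>m. card {v \<in> unimod. nroots v = m}"
  shows "6 * n 3 = card (SL2 :: 'a mat2 set)" "2 * n 1 = card (SL2 :: 'a mat2 set)"
    "3 * n 0 = card (SL2 :: 'a mat2 set)"
proof -
  let ?q = "card (UNIV :: 'a set)"
  have split: "(\<Sum>v\<in>unimod. f (nroots v)) = n 0 * f 0 + n 1 * f 1 + n 3 * f 3" for f :: "nat \<Rightarrow> nat"
  proof -
    have "(\<Sum>v\<in>unimod. f (nroots v)) = (\<Sum>m\<in>{0, 1, 3}. \<Sum>v | v \<in> unimod \<and> nroots v = m. f (nroots v))"
      by (intro sum.group[symmetric] finite_unimod image_subsetI nroots_unimod) auto
    also have "\<dots> = (\<Sum>m\<in>{0, 1, 3}. n m * f m)"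
      by (intro sum.cong refl) (simp add: n_def)
    finally show ?thesis by simp
  qed
  have "(\<Sum>v\<in>unimod. card {x \<in> UNIV. bform v (cub x) = 0}) = ?q * (?q - 1) * card (UNIV :: 'a option set)"
    by (intro sum_multicount finite_unimod) (auto simp: card_unimod_root simp del: cub_simps)
  then have 1: "n 1 + 3 * n 3 = card (SL2 :: 'a mat2 set)"
    using split[of id] by (simp add: nroots_def card_SL2 card_option)
  have "(\<Sum>v\<in>unimod. card {p \<in> {(x, y). x \<noteq> y}. bform v (cub (fst p)) = 0 \<and> bform v (cub (snd p)) = 0})
      = (?q - 1) * card {(x, y :: 'a option). x \<noteq> y}"
    by (intro sum_multicount finite_unimod) (auto simp: card_unimod_root2 simp del: cub_simps)
  moreover have "card {p \<in> {(x, y). x \<noteq> y}. bform v (cub (fst p)) = 0 \<and> bform v (cub (snd p)) = 0}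
      = nroots v * (nroots v - 1)" for v :: "'a vec4"
  proof -
    have "{p \<in> {(x, y). x \<noteq> y}. bform v (cub (fst p)) = 0 \<and> bform v (cub (snd p)) = 0}
       = {(x, y). x \<in> {x. bform v (cub x) = 0} \<and> y \<in> {x. bform v (cub x) = 0} \<and> x \<noteq> y}" by auto
    then show ?thesis unfolding nroots_def by (simp only: card_offdiag finite)
  qed
  moreover have "card {(x, y :: 'a option). x \<noteq> y} = (?q + 1) * ?q"
    using card_offdiag[of "UNIV :: 'a option set"] by (simp add: card_option)
  ultimately have 2: "6 * n 3 = card (SL2 :: 'a mat2 set)"
    using split[of "\<lambda>m. m * (m - 1)"] by (simp add: card_SL2 algebra_simps)
  have 3: "n 0 + n 1 + n 3 = card (SL2 :: 'a mat2 set)"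
    using split[of "\<lambda>_. 1"] card_unimod by simp
  show "6 * n 3 = card (SL2 :: 'a mat2 set)" "2 * n 1 = card (SL2 :: 'a mat2 set)"
    "3 * n 0 = card (SL2 :: 'a mat2 set)" using 1 2 3 by simp_all
qed


section \<open>Transitivity on each point type\<close>

text \<open>Every fibre of the orbit map is a coset of the stabilizer, so it has at most s
  elements.\<close>

lemma card_SL2_le_orbit:
  assumes v: "(v :: 'a vec4) \<in> vecs" and stab: "card {g \<in> SL2. act g v = v} \<le> s"
  shows "card (SL2 :: 'a mat2 set) \<le> s * card ((\<lambda>g. act g v) ` SL2)"
proof -
  have fibre: "card {g \<in> SL2. act g v = w} \<le> s" if w: "w \<in> (\<lambda>g. act g v) ` SL2" for w
  proof -
    obtain h where h: "h \<in> SL2" "w = act h v" using w by blast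
    have "card {g \<in> SL2. act g v = w} \<le> card {g \<in> SL2. act g v = v}"
    proof (rule card_inj_on_le[where f = "mmul (minv h)"])
      show "inj_on (mmul (minv h)) {g \<in> SL2. act g v = w}"
        by (rule inj_on_inverseI[of _ "mmul h"]) (rule mmul_minv_cancel[OF h(1)])
      show "mmul (minv h) ` {g \<in> SL2. act g v = w} \<subseteq> {g \<in> SL2. act g v = v}"
        using h v by (auto simp: mmul_SL2 minv_SL2 act_mmul[symmetric] act_minv simp del: act.simps mmul.simps minv.simps)
    qed simp
    then show ?thesis using stab by simp
  qed
  have "card (SL2 :: 'a mat2 set) = (\<Sum>w\<in>(\<lambda>g. act g v) ` SL2. card {g \<in> SL2. act g v = w})"
    using sum.image_gen[of SL2 "\<lambda>_. 1::nat" "\<lambda>g. act g v"] by simp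
  also have "\<dots> \<le> (\<Sum>w\<in>(\<lambda>g. act g v) ` (SL2 :: 'a mat2 set). s)"
    by (intro sum_mono fibre)
  finally show ?thesis by (simp add: mult.commute)
qed

text \<open>An upper bound on the stabilizer is a lower bound on the orbit; when it equals the size
  of the invariant set \<open>X\<close>, the orbit exhausts \<open>X\<close>.\<close>

lemma orbit_eq_of_stab:
  assumes X: "(X :: 'a vec4 set) \<subseteq> vecs" "finite X" "\<And>g v. g \<in> SL2 \<Longrightarrow> v \<in> X \<Longrightarrow> act g v \<in> X"
    and v: "v \<in> X" and stab: "card {g \<in> SL2. act g v = v} \<le> s"
    and size: "s * card X = card (SL2 :: 'a mat2 set)"
  shows "(\<lambda>g. act g v) ` SL2 = X"
proof (rule card_seteq[OF X(2)])
  have "s * card X \<le> s * card ((\<lambda>g. act g v) ` SL2)"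
    using card_SL2_le_orbit[OF _ stab] X(1) v size by auto
  moreover have "s \<noteq> 0"
  proof
    assume "s = 0"
    then have "SL2 = ({} :: 'a mat2 set)" using size by (simp add: card_eq_0_iff)
    then show False using one_SL2 by blast
  qed
  ultimately show "card X \<le> card ((\<lambda>g. act g v) ` SL2)" by simp
  show "(\<lambda>g. act g v) ` SL2 \<subseteq> X" using X(3) v by blast
qed

text \<open>Writing \<open>v\<close> as the matrix \<open>A\<close> with rows \<open>(v\<^sub>2, v\<^sub>0)\<close> and \<open>(v\<^sub>3, v\<^sub>1)\<close>, the action is twisted
  conjugation \<open>A \<mapsto> g A F(g)\<^sup>-\<^sup>1\<close> with \<open>F\<close> squaring the entries, so stabilizers are cut out by
  the low degree equations \<open>g A = A F(g)\<close>.\<close>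

lemma act_fixed_equations:
  assumes g: "(a, b, c, d) \<in> SL2" and fixed: "act (a, b, c, d) (v4 p q r s) = v4 p q r (s::'a)"
  shows "a * r + b * s = r * a^2 + p * c^2" "a * p + b * q = r * b^2 + p * d^2"
    "c * r + d * s = s * a^2 + q * c^2" "c * p + d * q = s * b^2 + q * d^2"
proof -
  have det: "a * d + b * c = 1" using g by (simp add: SL2_def)
  define y where "y = act (a, b, c, d) (v4 p q r s)"
  \<comment> \<open>Right multiplication of the matrix of \<open>y\<close> by F(g) undoes the
    twisted inverse, up to the square of the determinant.\<close>
  have "y 2 * a^2 + y 0 * c^2 = (a * d + b * c)^2 * (a * r + b * s)"
    "y 2 * b^2 + y 0 * d^2 = (a * d + b * c)^2 * (a * p + b * q)"
    "y 3 * a^2 + y 1 * c^2 = (a * d + b * c)^2 * (c * r + d * s)"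
    "y 3 * b^2 + y 1 * d^2 = (a * d + b * c)^2 * (c * p + d * q)"
    by (simp_all add: y_def algebra_simps power2_eq_square power3_eq_cube)
  then show "a * r + b * s = r * a^2 + p * c^2" "a * p + b * q = r * b^2 + p * d^2"
    "c * r + d * s = s * a^2 + q * c^2" "c * p + d * q = s * b^2 + q * d^2"
    using fixed det unfolding y_def[symmetric] by simp_all
qed

definition roottype :: "nat \<Rightarrow> 'a vec4 set" where
  "roottype m = {v \<in> unimod. nroots v = m}"

lemma roottype_act: "g \<in> SL2 \<Longrightarrow> v \<in> roottype m \<Longrightarrow> act g v \<in> roottype m"
  by (simp add: roottype_def act_unimod nroots_act unimod_vecs unimod_nz)

lemma roottype_subset: "roottype m \<subseteq> vecs" "finite (roottype m)"
  using finite_unimod by (auto simp: roottype_def unimod_vecs)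

lemma same_orbitI:
  assumes "g \<in> SL2" "h \<in> SL2" "v \<in> vecs" "w \<in> vecs" "act g v = act h (w :: 'a vec4)"
  shows "\<exists>k\<in>SL2. act k v = w"
proof
  show "mmul (minv h) g \<in> SL2" using assms by (simp add: mmul_SL2 minv_SL2)
  show "act (mmul (minv h) g) v = w"
    using assms act_minv(1)[of h w] by (simp flip: act_mmul)
qed

text \<open>Here explicit moves suffice: with two roots at infinity and zero, the cubic is b t + c
  t^2 with b c = 1, and a diagonal element makes it t + t^2.\<close>

lemma roottype3_transitive:
  assumes "v \<in> roottype 3" "w \<in> roottype 3"
  shows "\<exists>g\<in>SL2. act g v = w"
proof -
  have "\<exists>g\<in>SL2. act g v = v4 0 1 1 0" if v: "v \<in> roottype 3" for v
  proof -
    have "card {x. bform v (cub x) = 0} = 3" using v by (simp add: roottype_def nroots_def)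
    then obtain x y where xy: "x \<noteq> y" "bform v (cub x) = 0" "bform v (cub y) = 0"
      by (auto simp: card_3_iff)
    obtain g k where g: "g \<in> SL2" "k \<noteq> 0" "mapp g (hom x) = (1, 0)" "mapp g (hom y) = (0, k)"
      using xy(1) by (rule mapp_move2)
    have vu: "v \<in> unimod" using v by (simp add: roottype_def)
    then have "act g v \<in> unimod" using g act_unimod by blast
    then obtain a b c d where w: "act g v = v4 a b c d" "a * d + b * c = 1" by (rule unimodE)
    have "bform (act g v) (act g (cub x)) = 0" "bform (act g v) (act g (cub y)) = 0"
      using xy g vu by (simp_all add: bform_act unimod_vecs)
    then have ad: "d = 0" "a = 0" unfolding act_cub g w using g(2) by (simp_all add: tens_def)
    then have b: "b \<noteq> 0" "c = 1 / b" using w mult_eq_1D by auto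
    have "(1 / b, 0, 0, b) \<in> SL2" using b by (simp add: SL2_def)
    moreover have "act (1 / b, 0, 0, b) (act g v) = v4 0 1 1 0"
      unfolding w using ad b by (simp add: power2_eq_square)
    ultimately show ?thesis using g(1) mmul_SL2 unfolding act_mmul by blast
  qed
  then obtain g h where "g \<in> SL2" "h \<in> SL2" "act g v = act h w" using assms by metis
  then show ?thesis using same_orbitI assms roottype_subset(1) by blast
qed

text \<open>The normal form may still depend on parameters: the stabilizer bound is needed at just
  one vector of each orbit, and any such orbit is then the whole type.\<close>

lemma transitive_of_normal_form:
  assumes size: "s * card (roottype m) = card (SL2 :: 'a mat2 set)"
    and normal: "\<And>v. v \<in> roottype m \<Longrightarrow> \<exists>g\<in>SL2. card {h \<in> SL2. act h (act g v) = act g v} \<le> s"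
    and vw: "v \<in> roottype m" "w \<in> roottype m"
  shows "\<exists>g\<in>SL2. act g v = w"
proof -
  obtain g where g: "g \<in> SL2" "card {h \<in> SL2. act h (act g v) = act g v} \<le> s"
    using normal vw(1) by blast
  have "(\<lambda>h. act h (act g v)) ` SL2 = roottype m"
    using g size vw(1) roottype_subset roottype_act by (intro orbit_eq_of_stab) auto
  then have "w \<in> (\<lambda>h. act h (act g v)) ` SL2" using vw(2) by simp
  then obtain h where h: "w = act h (act g v)" "h \<in> SL2" by (rule imageE)
  then show ?thesis using g(1) mmul_SL2 act_mmul by metis
qed

text \<open>The normal form is t^2 + t + k without finite roots. Only the identity and the
  translation t -> t + 1 can fix it, and 2 is the index matching the size of the type.\<close>

lemma roottype1_transitive:
  assumes "v \<in> roottype 1" "w \<in> roottype 1"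
  shows "\<exists>g\<in>SL2. act g v = w"
proof (rule transitive_of_normal_form[OF _ _ assms])
  show "2 * card (roottype 1) = card (SL2 :: 'a mat2 set)"
    unfolding roottype_def by (rule card_unimod_types)
  fix v assume v: "v \<in> roottype 1"
  then have "card {x. bform v (cub x) = 0} = 1" "v \<in> unimod" by (auto simp: roottype_def nroots_def)
  then obtain x where "bform v (cub x) = 0" by (auto simp: card_1_singleton_iff)
  then obtain g k where g: "g \<in> SL2" "act g v = v4 k 1 1 0"
    using unimod_move_rootE \<open>v \<in> unimod\<close> by metis
  have "v4 k 1 1 0 \<in> roottype 1" using g v roottype_act by metis
  then have "nroots (v4 k 1 1 0) = 1" by (simp add: roottype_def)
  then have noroot: "k + t + t^2 \<noteq> 0" for t by (simp add: nroots_v4)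
  have "{h \<in> SL2. act h (v4 k 1 1 0) = v4 k 1 1 0} \<subseteq> {(1, 0, 0, 1), (1, 1, 0, 1)}"
  proof
    fix h :: "'a mat2" assume h: "h \<in> {h \<in> SL2. act h (v4 k 1 1 0) = v4 k 1 1 0}"
    obtain a b c d where abcd: "h = (a, b, c, d)" by (cases h)
    have det: "a * d + b * c = 1" using h abcd by (simp add: SL2_def)
    have eqs: "a = a^2 + k * c^2" "a * k + b = b^2 + k * d^2" "c = c^2" "c * k + d = d^2"
      using act_fixed_equations[of a b c d k 1 1 0] h abcd by (simp_all del: act.simps)
    have c: "c = 0 \<or> c = 1" using eqs(3) by (metis power2_eq_square mult_cancel_left1)
    \<comment> \<open>With c = 1 the first stabilizer equation makes a a root of t^2 + t +
      k.\<close>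
    have "c \<noteq> 1"
    proof
      assume "c = 1"
      then have "k + a + a^2 = a + (a^2 + k * c^2)" by (simp add: ac_simps)
      then have "k + a + a^2 = 0" unfolding eqs(1)[symmetric] by simp
      then show False using noroot by blast
    qed
    with c have c: "c = 0" by simp
    then have a: "a = 1" using eqs(1) det
      by (metis power2_eq_square mult_cancel_left1 mult_zero_left mult_zero_right add_0_right zero_neq_one power_zero_numeral)
    have d: "d = 1" using a c det by simp
    have "b = b^2" using eqs(2) a d by (simp add: add.commute)
    then have "b = 0 \<or> b = 1" by (metis power2_eq_square mult_cancel_left1)
    then show "h \<in> {(1, 0, 0, 1), (1, 1, 0, 1)}" using abcd a c d by auto
  qed
  then have "card {h \<in> SL2. act h (v4 k 1 1 0) = v4 k 1 1 0} \<le> card ({(1, 0, 0, 1), (1, 1, 0, 1)} :: 'a mat2 set)"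
    by (intro card_mono) auto
  then show "\<exists>g\<in>SL2. card {h \<in> SL2. act h (act g v) = act g v} \<le> 2"
    using g by (intro bexI[of _ g]) (auto simp del: act.simps)
qed

text \<open>The Tschirnhaus shift by c/d removes the t^2 term, as 3 = 1 is invertible.\<close>

lemma translate_kill:
  assumes "d \<noteq> (0::'a)"
  obtains g where "g \<in> SL2" "act g (v4 a b c d) =
    v4 (a + c / d * b) (b + c^2 / d) 0 d"
proof -
  have "act (1, c / d, 0, 1) (v4 a b c d) = v4 (a + c / d * b) (b + c^2 / d) 0 d"
    using assms by (simp add: field_simps power2_eq_square power3_eq_cube)
  moreover have "(1, c / d, 0, 1) \<in> SL2" by (simp add: SL2_def)
  ultimately show ?thesis using that by blast
qed

lemma roottype0_no_root:
  assumes "v4 a b c d \<in> roottype 0"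
  shows "d \<noteq> 0" "a + d * t^3 + b * t + c * t^2 \<noteq> (0::'a)" "a * d + b * c = 1"
proof -
  have n: "card {t. a + d * t^3 + b * t + c * t^2 = 0} + (if d = 0 then 1 else 0) = 0"
    using assms unfolding nroots_v4[symmetric] by (simp add: roottype_def)
  then show "d \<noteq> 0" by (auto split: if_splits)
  from n have "{t. a + d * t^3 + b * t + c * t^2 = 0} = {}" by simp
  then show "a + d * t^3 + b * t + c * t^2 \<noteq> 0" by blast
  show "a * d + b * c = 1" using assms by (simp add: roottype_def unimod_def)
qed

text \<open>The aim is a multiple of t^3 + m t + m, whose stabilizer equations can be solved by
  hand. Equalizing the linear and constant coefficients requires a nonzero linear one, which
  \<open>step2\<close> provides.\<close>

lemma roottype0_normal_form:
  assumes "v \<in> roottype 0"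
  obtains g p z where "g \<in> SL2" "act g v = v4 p p 0 z"
proof -
  have step1: "\<exists>g\<in>SL2. \<exists>a b d. act g v = v4 a b 0 d" if "v \<in> roottype 0" for v
  proof -
    have "v \<in> unimod" using that by (simp add: roottype_def)
    then obtain a b c d where v: "v = v4 a b c d" by (rule unimodE)
    then have "d \<noteq> 0" using that roottype0_no_root by blast
    then show ?thesis using translate_kill v by metis
  qed
  have step2: "\<exists>g\<in>SL2. \<exists>a b d. b \<noteq> 0 \<and> act g v = v4 a b 0 d" if vr: "v \<in> roottype 0" for v
  proof -
    obtain g a b d where g: "g \<in> SL2" "act g v = v4 a b 0 d" using step1 vr by blast
    show ?thesis
    proof (cases "b = 0")
      case True
      \<comment> \<open>The exceptional cubic d t^3 + a: a further group element followed by the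
        shift yields a nonzero linear coefficient. The new leading coefficient a + d is nonzero
        because 1 is not a root.\<close>
      have r: "v4 a 0 0 d \<in> roottype 0" using g vr roottype_act True by metis
      have ad: "a * d = 1" "a + d \<noteq> 0" using roottype0_no_root(2)[OF r, of 1] roottype0_no_root(3)[OF r] by auto
      have "act (0, 1, 1, 1) (v4 a 0 0 d) = v4 d d d (a + d)" by simp
      moreover obtain h where h: "h \<in> SL2" "act h (v4 d d d (a + d)) =
          v4 (d + d / (a + d) * d) (d + d^2 / (a + d)) 0 (a + d)"
        using translate_kill[OF ad(2)] by blast
      moreover have "d + d^2 / (a + d) \<noteq> 0"
      proof
        assume "d + d^2 / (a + d) = 0"
        then have "d * (a + d) + d^2 = 0" using ad(2) by (simp add: field_simps)
        then have "a * d = 0" by (simp add: algebra_simps power2_eq_square)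
        then show False using ad by simp
      qed
      moreover have "(0, 1, 1, 1) \<in> (SL2 :: 'a mat2 set)" by (simp add: SL2_def)
      moreover have "act (mmul h (mmul (0, 1, 1, 1) g)) v = act h (act (0, 1, 1, 1) (v4 a 0 0 d))"
        using g True by (simp flip: act_mmul del: act.simps)
      ultimately show ?thesis using g(1) mmul_SL2 by metis
    qed (use g in blast)
  qed
  obtain g a b d where g: "g \<in> SL2" "b \<noteq> 0" "act g v = v4 a b 0 d" using step2 assms by blast
  have "v4 a b 0 d \<in> roottype 0" using g assms roottype_act by metis
  then have ad: "a * d = 1" using roottype0_no_root by fastforce
  then have a0: "a \<noteq> 0" by auto
  \<comment> \<open>The diagonal element scales constant and linear coefficients by e^3 and e; they
    become equal when e^2 = b/a.\<close>
  obtain e where e: "e^2 = b / a" using sqrt_exists by blast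
  have e0: "e \<noteq> 0" using e g(2) a0 by auto
  have "e^3 * a = e * b" using e a0 by (simp add: power3_eq_cube power2_eq_square field_simps)
  then have "act (e, 0, 0, 1 / e) (v4 a b 0 d) = v4 (e * b) (e * b) 0 (d / e^3)"
    using e0 by (simp add: power2_eq_square power3_eq_cube)
  moreover have "(e, 0, 0, 1 / e) \<in> SL2" using e0 by (simp add: SL2_def)
  ultimately show ?thesis
    using that[of "mmul (e, 0, 0, 1 / e) g"] g mmul_SL2 by (simp flip: act_mmul del: act.simps mmul.simps)
qed

text \<open>The equations force the trace a + d into {0, 1}. Trace 0 leaves only the identity, as
  any other solution would be a root of t^3 + m t + m. Trace 1 forces c = 1 and b = m, with a
  satisfying a quadratic equation, so at most two further elements occur.\<close>

lemma roottype0_stab: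
  assumes "v4 p p 0 z \<in> roottype 0"
  shows "card {h \<in> SL2. act h (v4 p p 0 z) = v4 p p 0 z} \<le> 3"
proof -
  have pz: "p * z = 1" "z \<noteq> 0" and noroot: "\<And>t. p + z * t^3 + p * t \<noteq> 0"
    using roottype0_no_root[OF assms] by auto
  define m where "m = p / z"
  have p: "p = z * m" "m \<noteq> 0" using pz by (auto simp: m_def)
  have nr: "t^3 + m * t + m \<noteq> 0" for t
  proof
    assume "t^3 + m * t + m = 0"
    then have "z * (t^3 + m * t + m) = 0" by simp
    then have "p + z * t^3 + p * t = 0" by (simp add: p algebra_simps)
    then show False using noroot by blast
  qed
  have idem: "x = 0 \<or> x = 1" if "x^2 = x" for x :: 'a
    using that by (metis power2_eq_square mult_cancel_left1)
  define K :: "'a mat2 set" where "K = insert (1, 0, 0, 1) ((\<lambda>a. (a, m, 1, a + 1)) ` {a. a^2 + a + 1 = m})"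
  have "{h \<in> SL2. act h (v4 p p 0 z) = v4 p p 0 z} \<subseteq> K"
  proof
    fix h :: "'a mat2" assume h: "h \<in> {h \<in> SL2. act h (v4 p p 0 z) = v4 p p 0 z}"
    obtain a b c d where abcd: "h = (a, b, c, d)" by (cases h)
    have det: "a * d + b * c = 1" using h abcd by (simp add: SL2_def)
    have eqs: "b * z = p * c^2" "a * p + b * p = p * d^2" "d * z = z * a^2 + p * c^2"
      "c * p + d * p = z * b^2 + p * d^2"
      using act_fixed_equations[of a b c d p p 0 z] h abcd by (simp_all del: act.simps)
    have b: "b = m * c^2" using eqs(1) pz by (simp add: p algebra_simps)
    have "p * (a + b) = p * d^2" using eqs(2) by (simp add: algebra_simps)
    then have ab: "a + b = d^2" using p pz by simp
    have "z * d = z * (a^2 + b)" using eqs(3) b by (simp add: p algebra_simps)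
    then have d: "d = a^2 + b" using pz by simp
    have "z * (m * (c + d)) = z * (b^2 + m * d^2)" using eqs(4) by (simp add: p algebra_simps)
    then have e4: "m * (c + d) = b^2 + m * d^2" using pz by simp
    \<comment> \<open>The sum of the relations \<open>ab\<close> and \<open>d\<close>: the trace is
      idempotent.\<close>
    have "(a + d)^2 = a + d" using ab d by (simp add: sq_add add.commute add.left_commute flip: ab)
    then consider "a = d" | "d = a + 1" using idem by (metis add_eq_0_iff_eq add_self_left)
    then show "h \<in> K"
    proof cases
      case 1
      have "b = d + a^2" unfolding d by (simp add: ac_simps)
      then have b': "b = a * (a + 1)" using 1 by (simp add: power2_eq_square algebra_simps)
      \<comment> \<open>Otherwise eliminating b and c gives m (a + 1) = a^3, so a itself is a root
        of the cubic.\<close>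
      have "a = 0 \<or> a = 1"
      proof (rule ccontr)
        assume a: "\<not> (a = 0 \<or> a = 1)"
        then have a1: "a + 1 \<noteq> 0" by (simp add: add_eq_0_iff_eq)
        have "b * c = 1 + a * d" unfolding det[symmetric] by (simp add: ac_simps)
        then have "(a + 1) * (a * c) = (a + 1) * (a + 1)"
          unfolding b' 1[symmetric] by (simp add: algebra_simps)
        then have ac: "a * c = a + 1" using a1 unfolding mult_cancel_left by blast
        have "(a + 1) * (m * (a + 1)) = m * (a * c)^2" unfolding ac by (simp add: power2_eq_square)
        also have "\<dots> = a^2 * b" by (simp add: b power2_eq_square)
        also have "\<dots> = (a + 1) * a^3" by (simp add: b' power2_eq_square power3_eq_cube)
        finally have "m * (a + 1) = a^3" using a1 unfolding mult_cancel_left by blast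
        then have "a^3 + m * a + m = 0" by (simp add: algebra_simps flip: \<open>m * (a + 1) = a^3\<close>)
        then show False using nr by blast
      qed
      then have "b = 0" using b' by auto
      then have "c = 0" using b p by simp
      then have "a \<noteq> 0" using det 1 by auto
      then show ?thesis using \<open>a = 0 \<or> a = 1\<close> \<open>b = 0\<close> \<open>c = 0\<close> 1 abcd by (simp add: K_def)
    next
      case 2
      \<comment> \<open>Now a d = b + 1, so the determinant gives b c = b; once b = 0 is excluded, c
        = 1 and b = m.\<close>
      have b': "b = a^2 + a + 1" using d 2 by (metis add.assoc add.commute add_self_left)
      have "a * d = b + 1" using 2 b' by (simp add: power2_eq_square algebra_simps)
      then have "b * c = b" using det by (metis add.assoc add.commute add_self_left add_eq_0_iff_eq)
      moreover have "b \<noteq> 0"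
      proof
        assume b0: "b = 0"
        then have "c = 0" using b p by simp
        then have "d = d^2" using e4 b0 p by simp
        then have "d = 0 \<or> d = 1" using idem by metis
        then show False using det 2 b0 \<open>c = 0\<close> by auto
      qed
      ultimately have "c = 1" by simp
      then show ?thesis using abcd 2 b b' by (auto simp: K_def)
    qed
  qed
  then have "card {h \<in> SL2. act h (v4 p p 0 z) = v4 p p 0 z}
      \<le> card K"
    by (intro card_mono) auto
  also have "\<dots> \<le> Suc (card {a. a^2 + a + 1 = m})"
    unfolding K_def by (rule order_trans[OF card_insert_le_m1]) (auto simp: card_image_le)
  also have "card {a. a^2 + a + 1 = m} \<le> 2"
  proof (cases "{a. a^2 + a + 1 = m} = {}")
    case False
    then obtain s where s: "s^2 + s + 1 = m" by blast
    \<comment> \<open>The difference of two solutions satisfies x^2 = x, because a^2 + a is additive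
      in a.\<close>
    have "{a. a^2 + a + 1 = m} \<subseteq> {s, s + 1}"
    proof
      fix a assume "a \<in> {a. a^2 + a + 1 = m}"
      then have "a^2 + a + 1 = s^2 + s + 1" using s by simp
      then have "a^2 + a = s^2 + s" by (rule add_right_imp_eq)
      moreover have "(a + s)^2 + (a + s) = (a^2 + a) + (s^2 + s)" by (simp add: sq_add ac_simps)
      ultimately have "(a + s)^2 = a + s" by (simp add: add_eq_0_iff_eq)
      then consider "a + s = 0" | "a + s = 1" using idem by blast
      then show "a \<in> {s, s + 1}"
      proof cases
        case 2
        then have "a = s + 1" by (metis add.commute add_self_left)
        then show ?thesis by simp
      qed (simp add: add_eq_0_iff_eq)
    qed
    then have "card {a. a^2 + a + 1 = m} \<le> card {s, s + 1}" by (intro card_mono) auto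
    also have "\<dots> \<le> 2" by (simp add: card_insert_if)
    finally show ?thesis .
  qed simp
  finally show ?thesis by simp
qed

lemma roottype0_transitive:
  assumes "v \<in> roottype 0" "w \<in> roottype 0"
  shows "\<exists>g\<in>SL2. act g v = w"
proof (rule transitive_of_normal_form[OF _ _ assms])
  show "3 * card (roottype 0) = card (SL2 :: 'a mat2 set)"
    unfolding roottype_def by (rule card_unimod_types)
  fix v assume v: "v \<in> roottype 0"
  then obtain g p z where g: "g \<in> SL2" "act g v = v4 p p 0 z" by (rule roottype0_normal_form)
  then have "v4 p p 0 z \<in> roottype 0" using roottype_act v by metis
  then show "\<exists>g\<in>SL2. card {h \<in> SL2. act h (act g v) = act g v} \<le> 3"
    by (intro bexI[of _ g]) (simp_all only: g roottype0_stab)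
qed


section \<open>Point types as single orbits\<close>

lemma Gamma_points_eq: "{P. Gamma_point m P} = pt ` roottype m"
proof (intro equalityI subsetI)
  fix P :: "'a vec4 set" assume "P \<in> {P. Gamma_point m P}"
  then have P: "Gamma_point m P" by simp
  then have "P \<in> PG3" by (simp add: Gamma_point_def)
  then obtain a b c d where v: "P = pt (v4 a b c d)" "nz (v4 a b c d)" by (rule PG3E)
  let ?v = "v4 a b c d"
  have q: "qform ?v \<noteq> 0" "nroots ?v = m"
    using P v Gamma_point_pt_iff[of ?v m] by auto
  obtain k where k0: "k \<noteq> 0" and k: "smul k ?v \<in> unimod"
    using nonsingular_scale[OF v4_in_vecs q(1)] by blast
  have "nroots (smul k ?v) = m" using k0 q(2) by (simp del: smul_v4)
  with k have "smul k ?v \<in> roottype m" by (simp add: roottype_def)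
  moreover have "P = pt (smul k ?v)" using v k0 by (simp del: smul_v4)
  ultimately show "P \<in> pt ` roottype m" by blast
next
  fix P :: "'a vec4 set" assume "P \<in> pt ` roottype m"
  then obtain v where v: "P = pt v" "v \<in> unimod" "nroots v = m" by (auto simp: roottype_def)
  then have "qform v = 1" by (simp add: unimod_def)
  with v show "P \<in> {P. Gamma_point m P}" by (simp add: Gamma_point_pt_iff unimod_vecs unimod_nz)
qed

text \<open>Two normalized representatives of a point differ by k with k^2 = 1, and 1 is the only
  such k in characteristic 2.\<close>

lemma inj_on_pt_unimod: "inj_on pt unimod"
proof (rule inj_onI)
  fix u v :: "'a vec4" assume uv: "u \<in> unimod" "v \<in> unimod" "pt u = pt v"
  then obtain k where k: "u = smul k v" by (auto simp: pt_eq_iff)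
  have "k^2 = 1" using uv k by (simp add: unimod_def)
  then have "k = 1" using sq_eq_iff[of k 1] by simp
  then show "u = v" using k by (simp add: smul_def)
qed

lemma card_Gamma_points:
  "6 * card {P :: 'a vec4 set. Gamma_point 3 P} = card (SL2 :: 'a mat2 set)"
  "2 * card {P :: 'a vec4 set. Gamma_point 1 P} = card (SL2 :: 'a mat2 set)"
  "3 * card {P :: 'a vec4 set. Gamma_point 0 P} = card (SL2 :: 'a mat2 set)"
proof -
  have "card {P :: 'a vec4 set. Gamma_point m P} = card {v \<in> unimod. nroots v = m}" for m
    unfolding Gamma_points_eq roottype_def
    by (intro card_image inj_on_subset[OF inj_on_pt_unimod]) auto
  then show "6 * card {P :: 'a vec4 set. Gamma_point 3 P} = card (SL2 :: 'a mat2 set)"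
    "2 * card {P :: 'a vec4 set. Gamma_point 1 P} = card (SL2 :: 'a mat2 set)"
    "3 * card {P :: 'a vec4 set. Gamma_point 0 P} = card (SL2 :: 'a mat2 set)"
    by (simp_all only: card_unimod_types)
qed

lemma Gamma_points_transitive:
  assumes "m \<in> {0, 1, 3}" "Gamma_point m P" "Gamma_point m R"
  shows "\<exists>g\<in>SL2. pact g P = (R :: 'a vec4 set)"
proof -
  have "P \<in> pt ` roottype m" "R \<in> pt ` roottype m"
    using assms(2,3) by (simp_all flip: Gamma_points_eq)
  then obtain v w where vw: "P = pt v" "v \<in> roottype m" "R = pt w" "w \<in> roottype m"
    by (elim imageE)
  consider "m = 0" | "m = 1" | "m = 3" using assms(1) by blast
  then have "\<exists>g\<in>SL2. act g v = w"
    using vw(2,4) roottype0_transitive roottype1_transitive roottype3_transitive by cases simp_all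
  then obtain g where "g \<in> SL2" "act g v = w" by (rule bexE)
  then show ?thesis using vw(1,3) by (intro bexI[of _ g]) simp_all
qed

text \<open>A T-point is an ordered pair: its double root and its different simple root.\<close>

lemma T_points_eq: "{P. T_point P} = (\<lambda>(x, y). pt (tens (hom x) (hom y))) ` {(x, y :: 'a option). x \<noteq> y}"
proof (intro equalityI subsetI)
  fix P :: "'a vec4 set" assume "P \<in> {P. T_point P}"
  then have P: "T_point P" by simp
  then have "P \<in> PG3" by (simp add: T_point_def)
  then obtain a b c d where v: "P = pt (v4 a b c d)" "nz (v4 a b c d)" by (rule PG3E)
  then have q: "qform (v4 a b c d) = 0" "nroots (v4 a b c d) = 2"
    using P T_point_pt_iff[of "v4 a b c d"] by auto
  then obtain k x y where k: "k \<noteq> 0" "v4 a b c d = smul k (tens (hom x) (hom y))"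
    using v(2) singular_tensE v4_in_vecs by metis
  then have "card {x, y} = 2" using q(2) by (simp add: nroots_tens)
  then have "x \<noteq> y" by auto
  moreover have "P = pt (tens (hom x) (hom y))" unfolding v k using k(1) by simp
  ultimately show "P \<in> (\<lambda>(x, y). pt (tens (hom x) (hom y))) ` {(x, y :: 'a option). x \<noteq> y}" by blast
next
  fix P assume "P \<in> (\<lambda>(x, y). pt (tens (hom x) (hom y))) ` {(x, y :: 'a option). x \<noteq> y}"
  then obtain x y where "x \<noteq> y" "P = pt (tens (hom x) (hom (y :: 'a option)))" by blast
  then show "P \<in> {P. T_point P}" by (simp add: T_point_pt_iff nroots_tens)
qed

lemma card_T_points: "card {P :: 'a vec4 set. T_point P} = (card (UNIV::'a set) + 1) * card (UNIV::'a set)"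
proof -
  have "inj_on (\<lambda>(x, y). pt (tens (hom x) (hom y))) {(x, y :: 'a option). x \<noteq> y}"
    by (auto simp: inj_on_def pt_tens_eq_iff)
  then have "card {P :: 'a vec4 set. T_point P} = card {(x, y :: 'a option). x \<noteq> y}"
    unfolding T_points_eq by (rule card_image)
  then show ?thesis using card_offdiag[of "UNIV :: 'a option set"] by (simp add: card_option)
qed

text \<open>The group is 2-transitive on the projective line, so every T-point can be moved to the
  pair (infinity, zero); the leftover scalar \<open>k\<close> is invisible projectively.\<close>

lemma T_points_transitive:
  assumes "T_point P" "T_point R"
  shows "\<exists>g\<in>SL2. pact g P = (R :: 'a vec4 set)"
proof -
  have *: "\<exists>g\<in>SL2. pact g P = pt (v4 0 1 0 0)" if P: "T_point P" for P :: "'a vec4 set"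
  proof -
    have "P \<in> (\<lambda>(x, y). pt (tens (hom x) (hom y))) ` {(x, y :: 'a option). x \<noteq> y}"
      using P by (simp flip: T_points_eq)
    then obtain x y where xy: "x \<noteq> y" "P = pt (tens (hom x) (hom (y :: 'a option)))" by auto
    obtain g k where g: "g \<in> SL2" "k \<noteq> 0" "mapp g (hom x) = (1, 0)" "mapp g (hom y) = (0, k)"
      using xy(1) by (rule mapp_move2)
    have "act g (tens (hom x) (hom y)) = smul k (v4 0 1 0 0)"
      unfolding act_tens g(3,4) by (simp add: tens_def)
    then have "pact g P = pt (v4 0 1 0 0)" unfolding xy pact_pt using g(2) by (simp del: smul_v4)
    then show ?thesis using g(1) by blast
  qed
  obtain g h where gh: "g \<in> SL2" "h \<in> SL2" "pact g P = pt (v4 0 1 0 0)" "pact h R = pt (v4 0 1 0 0)"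
    using *[OF assms(1)] *[OF assms(2)] by blast
  have PR: "P \<in> PG3" "R \<in> PG3" using assms by (auto simp: T_point_def)
  have "pact (mmul (minv h) g) P = pact (minv h) (pact h R)"
    using gh PR by (simp flip: pact_mmul)
  also have "\<dots> = R" by (rule pact_minv(1)[OF gh(2) PR(2)])
  finally show ?thesis using gh mmul_SL2 minv_SL2 by blast
qed

lemma point_type_pact:
  assumes "(g::'a mat2) \<in> SL2" "P \<in> PG3"
  shows "T_point (pact g P) \<longleftrightarrow> T_point P" "Gamma_point m (pact g P) \<longleftrightarrow> Gamma_point m P"
proof -
  obtain a b c d where v: "P = pt (v4 a b c d)" "nz (v4 a b c d)" using assms(2) by (rule PG3E)
  show "T_point (pact g P) \<longleftrightarrow> T_point P" "Gamma_point m (pact g P) \<longleftrightarrow> Gamma_point m P"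
    using assms(1) v by (simp_all add: T_point_pt_iff Gamma_point_pt_iff nz_act qform_act nroots_act
        del: act.simps qform_v4 nz_v4)
qed

section \<open>Line orbits\<close>

lemma sact_mmul: "L \<subseteq> PG3 \<Longrightarrow> sact (g::'a mat2) (sact h L) = sact (mmul g h) L"
  unfolding sact_def image_image by (intro image_cong refl pact_mmul) auto

lemma sact_one: "L \<subseteq> PG3 \<Longrightarrow> sact (1, 0, 0, 1) L = (L :: 'a vec4 set set)"
proof -
  assume L: "L \<subseteq> PG3"
  have "pact (1, 0, 0, 1) P = P" if P: "P \<in> PG3" for P :: "'a vec4 set"
  proof -
    obtain a b c d where "P = pt (v4 a b c d)" using P by (rule PG3E)
    then show ?thesis by (simp add: act_one del: act.simps)
  qed
  then show ?thesis using L by (force simp: sact_def)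
qed

lemma sact_minv:
  assumes "(g::'a mat2) \<in> SL2" "L \<subseteq> PG3"
  shows "sact (minv g) (sact g L) = L" "sact g (sact (minv g) L) = L"
  using assms by (simp_all add: sact_mmul mmul_minv sact_one)

lemma sact_subset_PG3: "(g::'a mat2) \<in> SL2 \<Longrightarrow> L \<subseteq> PG3 \<Longrightarrow> sact g L \<subseteq> PG3"
  by (auto simp: sact_def intro: pact_in_PG3)

definition orbit :: "'a vec4 set set \<Rightarrow> 'a vec4 set set set" where
  "orbit L = (\<lambda>g. sact g L) ` SL2"

lemma orbit_subset_PG3: "L \<subseteq> PG3 \<Longrightarrow> l \<in> orbit L \<Longrightarrow> l \<subseteq> PG3"
  unfolding orbit_def by (elim imageE) (simp add: sact_subset_PG3)

lemma orbit_sact: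
  assumes "g \<in> SL2" "L \<subseteq> PG3" "l \<in> orbit L" shows "sact g l \<in> orbit L"
proof -
  obtain h where h: "l = sact h L" "h \<in> SL2" using assms(3) unfolding orbit_def by (rule imageE)
  then have "sact g l = sact (mmul g h) L" using assms(2) by (simp add: sact_mmul)
  then show ?thesis using assms(1) h(2) mmul_SL2 unfolding orbit_def by blast
qed

lemma card_sact_points:
  assumes "g \<in> SL2" "L \<subseteq> PG3" "\<And>P. P \<in> PG3 \<Longrightarrow> X (pact g P) \<longleftrightarrow> X P"
  shows "card {P \<in> sact g L. X P} = card {P \<in> (L :: 'a vec4 set set). X P}"
proof -
  have "{P \<in> sact g L. X P} = pact g ` {P \<in> L. X P}" using assms by (auto simp: sact_def)
  moreover have "inj_on (pact g) {P \<in> L. X P}"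
    using inj_on_pact[OF assms(1)] assms(2) by (auto intro: inj_on_subset)
  ultimately show ?thesis by (simp add: card_image)
qed

text \<open>Incident pairs (line of the orbit, point of type \<open>X\<close>) are counted both
  ways; transitivity on lines and on points makes both local counts constant.\<close>

lemma line_count:
  assumes L: "L \<subseteq> PG3" and inv: "\<And>g P. g \<in> SL2 \<Longrightarrow> P \<in> PG3 \<Longrightarrow> X (pact g P) \<longleftrightarrow> X P"
    and PG3: "\<And>P. X P \<Longrightarrow> P \<in> PG3"
    and trans: "\<And>P R. X P \<Longrightarrow> X R \<Longrightarrow> \<exists>g\<in>SL2. pact g P = (R :: 'a vec4 set)"
    and P: "X P"
  shows "card {l \<in> orbit L. P \<in> l} * card {P. X P} = card (orbit L) * card {P \<in> L. X P}"
proof -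
  have fin: "finite (orbit L)" by (simp add: orbit_def)
  have finX: "finite {P. X P}" using PG3 finite_PG3 by (metis finite_subset mem_Collect_eq subsetI)
  \<comment> \<open>Equality follows by exchanging the two points, as transitivity is symmetric in
    them.\<close>
  have le: "card {l \<in> orbit L. P \<in> l} \<le> card {l \<in> orbit L. R \<in> l}" if PR: "X P" "X R" for P R
  proof -
    obtain g where g: "g \<in> SL2" "pact g P = R" using trans PR by blast
    show ?thesis
    proof (rule card_inj_on_le[where f = "sact g"])
      show "inj_on (sact g) {l \<in> orbit L. P \<in> l}"
        by (rule inj_on_inverseI[of _ "sact (minv g)"]) (use sact_minv(1)[OF g(1)] orbit_subset_PG3[OF L] in blast)
      show "sact g ` {l \<in> orbit L. P \<in> l} \<subseteq> {l \<in> orbit L. R \<in> l}"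
        using orbit_sact[OF g(1) L] g(2) by (auto simp: sact_def)
    qed (use fin in simp)
  qed
  have "(\<Sum>l\<in>orbit L. card {R \<in> {P. X P}. R \<in> l}) = card {l \<in> orbit L. P \<in> l} * card {P. X P}"
    by (rule sum_multicount[OF fin finX]) (use le P in \<open>auto intro: le_antisym\<close>)
  moreover have "card {R \<in> {P. X P}. R \<in> l} = card {P \<in> L. X P}" if l: "l \<in> orbit L" for l
  proof -
    obtain g where g: "l = sact g L" "g \<in> SL2" using l unfolding orbit_def by (rule imageE)
    have "{R \<in> {P. X P}. R \<in> l} = {P \<in> sact g L. X P}" using g by blast
    then show ?thesis using card_sact_points[of g L X] g L inv by simp
  qed
  ultimately show ?thesis by simp
qed

lemma card_orbit:
  assumes L: "L \<subseteq> (PG3 :: 'a vec4 set set)" and stab: "card {g \<in> SL2. sact g L = L} = s"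
  shows "card (SL2 :: 'a mat2 set) = s * card (orbit L)"
proof -
  have "card {g \<in> SL2. sact g L = l} = s" if l: "l \<in> orbit L" for l
  proof -
    obtain h where h: "l = sact h L" "h \<in> SL2" using l unfolding orbit_def by (rule imageE)
    have "bij_betw (mmul h) {g \<in> SL2. sact g L = L} {g \<in> SL2. sact g L = l}"
    proof (rule bij_betw_byWitness[where f' = "mmul (minv h)"])
      show "mmul h ` {g \<in> SL2. sact g L = L} \<subseteq> {g \<in> SL2. sact g L = l}"
        using h L by (auto simp: mmul_SL2 sact_mmul[symmetric] simp del: mmul.simps)
      show "mmul (minv h) ` {g \<in> SL2. sact g L = l} \<subseteq> {g \<in> SL2. sact g L = L}"
        using h L by (auto simp: mmul_SL2 minv_SL2 sact_mmul[symmetric] sact_minv simp del: mmul.simps minv.simps)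
    qed (use h in \<open>auto simp: mmul_minv_cancel minv_mmul_cancel simp del: mmul.simps minv.simps\<close>)
    from bij_betw_same_card[OF this] show ?thesis using stab by simp
  qed
  then show ?thesis
    using sum.image_gen[of SL2 "\<lambda>_. 1::nat" "\<lambda>g. sact g L"] by (simp add: orbit_def mult.commute)
qed

section \<open>The line \<open>ell mu\<close> and its stabilizer\<close>

lemma ell_eq_pts: "ell mu = {pt (v4 b (a * mu) b a) | a b. a \<noteq> 0 \<or> b \<noteq> (0::'a)}"
  unfolding ell_def line_of_def by simp

lemma ell_eq: "ell mu = insert (pt (v4 1 0 1 0)) (range (\<lambda>c. pt (v4 c mu c (1::'a))))"
proof -
  have "pt (v4 b (a * mu) b a) \<in> insert (pt (v4 1 0 1 0)) (range (\<lambda>c. pt (v4 c mu c (1::'a))))"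
    if "a \<noteq> 0 \<or> b \<noteq> 0" for a b
  proof (cases "a = 0")
    case True
    then have "v4 b (a * mu) b a = smul b (v4 1 0 1 0)" "b \<noteq> 0" using that by auto
    then show ?thesis by (simp del: smul_v4)
  next
    case False
    then have "v4 b (a * mu) b a = smul a (v4 (b / a) mu (b / a) 1)" by simp
    then show ?thesis using False by (simp del: smul_v4)
  qed
  moreover have "pt (v4 1 0 1 0) \<in> ell mu"
    unfolding ell_eq_pts by (rule CollectI, rule exI[of _ 0], rule exI[of _ 1]) simp
  moreover have "pt (v4 c mu c 1) \<in> ell mu" for c
    unfolding ell_eq_pts by (rule CollectI, rule exI[of _ 1], rule exI[of _ c]) simp
  ultimately show ?thesis unfolding ell_eq_pts by blast
qed

lemma ell_subset_PG3: "ell mu \<subseteq> (PG3 :: 'a vec4 set set)"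
  by (auto simp: ell_eq)

lemma inj_ell_pt: "inj (\<lambda>c. pt (v4 c mu c (1::'a)))"
  by (auto intro!: injI simp: pt_eq_iff)

text \<open>The cubics are t^2 + 1 = (t + 1)^2 with a simple root at infinity, and t^3 + mu t = t (t
  + s)^2 with s^2 = mu.\<close>

lemma ell_special_nroots:
  "nroots (v4 1 0 1 (0::'a)) = 2" "mu \<noteq> 0 \<Longrightarrow> nroots (v4 0 mu 0 (1::'a)) = 2"
proof -
  have "v4 1 0 1 (0::'a) = tens (hom (Some 1)) (hom None)" by (simp add: tens_def)
  then show "nroots (v4 1 0 1 (0::'a)) = 2" by (simp only: nroots_tens) simp
  assume "mu \<noteq> 0"
  obtain s where s: "s^2 = mu" using sqrt_exists by blast
  then have "v4 0 mu 0 (1::'a) = tens (hom (Some s)) (hom (Some 0))" by (simp add: tens_def)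
  moreover have "s \<noteq> 0" using s \<open>mu \<noteq> 0\<close> by auto
  ultimately show "nroots (v4 0 mu 0 (1::'a)) = 2" by (simp add: nroots_tens del: hom_simps)
qed

text \<open>The value is c (1 + mu); for mu = 1 the whole line would lie on the quadric.\<close>

lemma qform_ell: "mu \<noteq> 1 \<Longrightarrow> qform (v4 c mu c (1::'a)) = 0 \<longleftrightarrow> c = 0"
proof -
  assume "mu \<noteq> 1"
  have "qform (v4 c mu c 1) = c * (1 + mu)" by (simp add: algebra_simps)
  moreover have "1 + mu \<noteq> 0" using \<open>mu \<noteq> 1\<close> by (simp add: add_eq_0_iff_eq)
  ultimately show ?thesis by simp
qed

lemma qform_special: "qform (v4 1 0 1 (0::'a)) = 0"
  by simp

context
  fixes mu :: 'a
  assumes mu: "mu \<noteq> 0" "mu \<noteq> 1"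
begin

lemma T_points_ell: "{P \<in> ell mu. T_point P} = {pt (v4 1 0 1 0), pt (v4 0 mu 0 1)}"
  using mu qform_special by (auto simp: ell_eq T_point_pt_iff ell_special_nroots qform_ell simp del: qform_v4)

lemma ell_special_neq: "pt (v4 1 0 1 0) \<noteq> pt (v4 0 mu 0 (1::'a))"
  by (auto simp: pt_eq_iff)

lemma ell_not_tcubic:
  assumes "P \<in> ell mu" shows "P \<notin> tcubic"
proof -
  consider "P = pt (v4 1 0 1 0)" | c where "P = pt (v4 c mu c 1)" using assms unfolding ell_eq by blast
  then show ?thesis
  proof cases
    case (2 c)
    then show ?thesis using mu ell_special_nroots(2)[of mu]
      by (cases "c = 0") (simp_all add: tcubic_pt_iff qform_ell del: qform_v4)
  qed (simp add: tcubic_pt_iff ell_special_nroots)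
qed

text \<open>A stabilizing element permutes the two T-points of the line. If it fixes both, it fixes
  their double and simple roots and is the identity; if it swaps them, it is antidiagonal with e^4 =
  mu.\<close>

lemma ell_stab_cases:
  assumes g: "g \<in> SL2" and st: "sact g (ell mu) = ell mu"
  shows "g = (1, 0, 0, 1) \<or> (\<exists>e. g = (0, e, 1 / e, 0) \<and> e^4 = mu)"
proof -
  let ?P = "pt (v4 1 0 1 0)" and ?R = "pt (v4 0 mu 0 1)"
  have img: "pact g P \<in> {?P, ?R}" if P: "P \<in> {?P, ?R}" for P
  proof -
    have P': "P \<in> ell mu" "T_point P" using P T_points_ell by blast+
    then have "pact g P \<in> ell mu" using st by (auto simp: sact_def)
    moreover have "T_point (pact g P)"
      using P' point_type_pact(1)[OF g] by (simp add: T_point_def)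
    ultimately show ?thesis using T_points_ell by blast
  qed
  have neq: "pact g ?P \<noteq> pact g ?R"
    using inj_on_eq_iff[OF inj_on_pact[OF g], of ?P ?R] ell_special_neq by simp
  obtain a b c d where abcd: "g = (a, b, c, d)" by (cases g)
  have det: "a * d + b * c = 1" using g abcd by (simp add: SL2_def)
  \<comment> \<open>The images stay in factored form, since both points are pure tensors and
    \<open>act\<close> acts on each factor.\<close>
  have act1: "act g (v4 1 0 1 0) = v4 (a * (a + b)^2) (c * (a + b)^2) (a * (c + d)^2) (c * (c + d)^2)"
    by (simp add: abcd sq_add algebra_simps power2_eq_square power3_eq_cube)
  have act2: "act g (v4 0 mu 0 1) = v4 (b * (a^2 * mu + b^2)) (d * (a^2 * mu + b^2))
      (b * (c^2 * mu + d^2)) (d * (c^2 * mu + d^2))"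
    by (simp add: abcd algebra_simps power2_eq_square power3_eq_cube)
  consider "pact g ?P = ?P" "pact g ?R = ?R" | "pact g ?P = ?R" "pact g ?R = ?P"
    using img neq by blast
  then show ?thesis
  proof cases
    case 1
    then obtain k l where k: "k \<noteq> 0" "act g (v4 1 0 1 0) = smul k (v4 1 0 1 0)"
      and l: "l \<noteq> 0" "act g (v4 0 mu 0 1) = smul l (v4 0 mu 0 1)"
      by (auto simp: pt_eq_iff simp del: act.simps smul_v4)
    have e1: "a * (a + b)^2 = k" "c * (a + b)^2 = 0" "a * (c + d)^2 = k"
      using k(2) unfolding act1 by simp_all
    have e2: "b * (c^2 * mu + d^2) = 0" "d * (c^2 * mu + d^2) = l"
      using l(2) unfolding act2 by simp_all
    have c: "c = 0" using e1 k(1) by auto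
    have b: "b = 0" using e2 l(1) by auto
    have "a \<noteq> 0" using e1 k(1) by auto
    moreover have "a * a^2 = a * d^2" using e1(1,3) b c by simp
    ultimately have ad: "a = d" by simp
    then have "a^2 = 1^2" using det b c by (simp add: power2_eq_square)
    then have "a = 1" by (simp only: sq_eq_iff)
    then show ?thesis using abcd ad b c by simp
  next
    case 2
    then obtain k l where k: "k \<noteq> 0" "act g (v4 1 0 1 0) = smul k (v4 0 mu 0 1)"
      and l: "l \<noteq> 0" "act g (v4 0 mu 0 1) = smul l (v4 1 0 1 0)"
      by (auto simp: pt_eq_iff simp del: act.simps smul_v4)
    have e1: "a * (a + b)^2 = 0" "c * (a + b)^2 = k * mu"
      using k(2) unfolding act1 by simp_all
    have e2: "b * (a^2 * mu + b^2) = l" "d * (a^2 * mu + b^2) = 0" "b * (c^2 * mu + d^2) = l"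
      using l(2) unfolding act2 by simp_all
    have a: "a = 0" using e1 k(1) mu by auto
    have d: "d = 0" using e2 l(1) by auto
    have bc: "b \<noteq> 0" "c = 1 / b" using det a mult_eq_1D by auto
    have "b * b^2 = b * (c^2 * mu)" using e2(1,3) a d by simp
    then have "b^2 = c^2 * mu" using bc by simp
    then have "b^4 = mu" using bc by (simp add: field_simps power2_eq_square eval_nat_numeral)
    then show ?thesis using abcd a bc d by blast
  qed
qed

text \<open>Fourth roots exist and are unique in characteristic 2, so exactly one swapping element
  occurs, and it is an involution.\<close>

lemma card_ell_stab: "card {g \<in> SL2. sact g (ell mu) = ell mu} = 2"
proof -
  obtain f where f: "f^2 = mu" using sqrt_exists by blast
  obtain e where e: "e^2 = f" using sqrt_exists by blast
  have e4: "e^4 = mu" using e f by (metis numeral_Bit0_eq_double power_mult mult_2 power_even_eq)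
  have e0: "e \<noteq> 0" using e4 mu by auto
  define g :: "'a mat2" where "g = (0, e, 1 / e, 0)"
  have g: "g \<in> SL2" using e0 by (simp add: g_def SL2_def)
  have sub: "sact g (ell mu) \<subseteq> ell mu"
  proof
    fix P assume "P \<in> sact g (ell mu)"
    then obtain R where R: "P = pact g R" "R \<in> ell mu" unfolding sact_def by (rule imageE)
    from R(2) obtain a b where "a \<noteq> 0 \<or> b \<noteq> 0" "R = pt (v4 b (a * mu) b a)"
      unfolding ell_eq_pts by blast
    with R(1) have ab: "a \<noteq> 0 \<or> b \<noteq> 0" "P = pt (act g (v4 b (a * mu) b a))" by simp_all
    have "act g (v4 b (a * mu) b a) = v4 (e^3 * a) (b / e^3 * mu) (e^3 * a) (b / e^3)"
      using e0 by (simp add: g_def field_simps flip: e4) (simp add: eval_nat_numeral algebra_simps)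
    moreover have "b / e^3 \<noteq> 0 \<or> e^3 * a \<noteq> 0" using ab e0 by auto
    ultimately show "P \<in> ell mu" unfolding ell_eq_pts ab(2)
      by (intro CollectI exI[of _ "b / e^3"] exI[of _ "e^3 * a"] conjI) (simp_all only:)
  qed
  have "mmul g g = (1, 0, 0, 1)" using e0 by (simp add: g_def)
  then have "ell mu = sact g (sact g (ell mu))" by (simp add: sact_mmul sact_one ell_subset_PG3)
  also have "\<dots> \<subseteq> sact g (ell mu)" using sub by (auto simp: sact_def)
  finally have stab: "sact g (ell mu) = ell mu" using sub by blast
  have "{g \<in> SL2. sact g (ell mu) = ell mu} = {(1, 0, 0, 1), g}"
  proof (intro equalityI subsetI)
    fix h assume "h \<in> {g \<in> SL2. sact g (ell mu) = ell mu}"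
    then consider "h = (1, 0, 0, 1)" | e' where "h = (0, e', 1 / e', 0)" "e'^4 = mu"
      using ell_stab_cases by blast
    then show "h \<in> {(1, 0, 0, 1), g}"
    proof cases
      case (2 e')
      then have "(e'^2)^2 = (e^2)^2" using e4 by simp
      then have "e' = e" by (simp only: sq_eq_iff)
      then show ?thesis using 2 by (simp add: g_def)
    qed simp
  next
    fix h assume "h \<in> {(1, 0, 0, 1), g}"
    then consider "h = (1, 0, 0, 1)" | "h = g" by blast
    then show "h \<in> {g \<in> SL2. sact g (ell mu) = ell mu}"
      by cases (simp_all add: g stab one_SL2 sact_one[OF ell_subset_PG3])
  qed
  then show ?thesis by (simp add: g_def)
qed

section \<open>Points on a line of the orbit, and lines through a point\<close>

lemma nroots_ell: "nroots (v4 c mu c 1) = card {t. t^3 + c * t^2 + mu * t + c = 0}"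
  by (simp add: nroots_v4 ac_simps)

lemma card_Gamma_ell:
  assumes "m \<noteq> 2"
  shows "card {P \<in> ell mu. Gamma_point m P} = card {c. card {t. t^3 + c * t^2 + mu * t + c = 0} = m}"
proof -
  have "{P \<in> ell mu. Gamma_point m P}
      = (\<lambda>c. pt (v4 c mu c 1)) ` {c. c \<noteq> 0 \<and> nroots (v4 c mu c 1) = m}"
    using mu qform_special by (auto simp: ell_eq Gamma_point_pt_iff qform_ell simp del: qform_v4)
  \<comment> \<open>The value c = 0 belongs to a T-point with two roots, so it satisfies neither
    description when m differs from 2.\<close>
  also have "{c. c \<noteq> 0 \<and> nroots (v4 c mu c 1) = m} = {c. nroots (v4 c mu c 1) = m}"
    using assms ell_special_nroots(2)[OF mu(1)] by auto
  finally show ?thesis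
    by (simp add: card_image inj_on_subset[OF inj_ell_pt] nroots_ell)
qed

text \<open>Besides the number of parameters, one more relation is needed: the total number of roots
  over all c. Every t other than 1 is a root for exactly one c, so the total is q - 1; the parameter
  c = 0 contributes 2 of these.\<close>

lemma Gamma_ell_counts:
  shows "card {P \<in> ell mu. Gamma_point 1 P} = N1 mu"
    "3 * card {P \<in> ell mu. Gamma_point 3 P} + 3 + N1 mu = card (UNIV :: 'a set)"
    "3 * card {P \<in> ell mu. Gamma_point 0 P} + 2 * N1 mu = 2 * card (UNIV :: 'a set)"
proof -
  let ?q = "card (UNIV :: 'a set)"
  define n where "n c = nroots (v4 c mu c 1)" for c
  define A where "A m = card {c. n c = m}" for m
  have Acard: "card {P \<in> ell mu. Gamma_point m P} = A m" if "m \<noteq> 2" for m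
    using card_Gamma_ell[OF that] by (simp add: A_def n_def nroots_ell)
  show 1: "card {P \<in> ell mu. Gamma_point 1 P} = N1 mu"
    using card_Gamma_ell[of 1] by (simp add: N1_def)
  have vals: "n c \<in> {0, 1, 2, 3}" and two: "n c = 2 \<longleftrightarrow> c = 0" for c
  proof -
    have n0: "n 0 = 2" using ell_special_nroots(2)[OF mu(1)] by (simp add: n_def)
    have nz: "n c \<in> {0, 1, 3}" if c: "c \<noteq> 0"
      using nroots_nonsingular[of "v4 c mu c 1"] qform_ell[OF mu(2), of c] c
      by (simp add: n_def del: qform_v4)
    show "n c \<in> {0, 1, 2, 3}" "n c = 2 \<longleftrightarrow> c = 0"
      using n0 nz by (cases "c = 0"; auto)+
  qed
  have split: "(\<Sum>c\<in>UNIV. f (n c)) = A 0 * f 0 + A 1 * f 1 + f 2 + A 3 * f 3" for f :: "nat \<Rightarrow> nat"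
  proof -
    have "(\<Sum>c\<in>UNIV. f (n c)) = (\<Sum>m\<in>{0, 1, 2, 3}. \<Sum>c | c \<in> UNIV \<and> n c = m. f (n c))"
      by (intro sum.group[symmetric] image_subsetI vals) auto
    also have "\<dots> = (\<Sum>m\<in>{0, 1, 2, 3}. A m * f m)"
      by (intro sum.cong refl) (simp add: A_def)
    also have "A 2 = 1" by (simp add: A_def two)
    then have "(\<Sum>m\<in>{0, 1, 2, 3}. A m * f m) = A 0 * f 0 + A 1 * f 1 + f 2 + A 3 * f 3" by simp
    finally show ?thesis .
  qed
  have q: "?q = A 0 + A 1 + 1 + A 3" using split[of "\<lambda>_. 1"] by simp
  have "(\<Sum>c\<in>UNIV. card {t \<in> UNIV - {1}. t^3 + c * t^2 + mu * t + c = 0}) = 1 * card (UNIV - {1 :: 'a})"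
  proof (rule sum_multicount)
    show "\<forall>t\<in>UNIV - {1}. card {c \<in> UNIV. t^3 + c * t^2 + mu * t + c = 0} = 1"
    proof
      fix t :: 'a assume "t \<in> UNIV - {1}"
      then have "t^2 \<noteq> 1^2" by (simp only: sq_eq_iff) simp
      then have t: "t^2 + 1 \<noteq> 0" by (simp add: add_eq_0_iff_eq)
      have "t^3 + c * t^2 + mu * t + c = 0 \<longleftrightarrow> c = (t^3 + mu * t) / (t^2 + 1)" for c
      proof -
        have *: "t^3 + c * t^2 + mu * t + c = c * (t^2 + 1) + (t^3 + mu * t)" by (simp add: algebra_simps)
        show ?thesis unfolding * using t by (simp add: add_eq_0_iff_eq eq_divide_eq)
      qed
      then show "card {c \<in> UNIV. t^3 + c * t^2 + mu * t + c = 0} = 1" by simp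
    qed
  qed auto
  moreover have "card {t \<in> UNIV - {1}. t^3 + c * t^2 + mu * t + c = 0} = n c" for c
  proof -
    \<comment> \<open>At t = 1 the cubic has the value 1 + mu for every c, so omitting t = 1 loses
      no root.\<close>
    have "1 + c + mu + c \<noteq> 0" using mu by (simp add: add_eq_0_iff_eq ac_simps)
    then have "{t \<in> UNIV - {1}. t^3 + c * t^2 + mu * t + c = 0} = {t. t^3 + c * t^2 + mu * t + c = 0}"
      by auto
    then show ?thesis by (simp add: n_def nroots_ell)
  qed
  ultimately have "(\<Sum>c\<in>UNIV. n c) = ?q - 1" by (simp add: card_Diff_singleton)
  then have s: "A 1 + 2 + 3 * A 3 = ?q - 1" using split[of id] by simp
  have N: "N1 mu = A 1" using 1 Acard[of 1] by simp
  show "3 * card {P \<in> ell mu. Gamma_point 3 P} + 3 + N1 mu = ?q"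
    using s q N Acard[of 3] by simp
  show "3 * card {P \<in> ell mu. Gamma_point 0 P} + 2 * N1 mu = 2 * ?q"
    using s q N Acard[of 0] by simp
qed

lemma orbit_point_counts:
  assumes l: "l \<in> orbit (ell mu)"
  shows "P \<in> l \<Longrightarrow> P \<notin> tcubic"
    "card {P \<in> l. T_point P} = 2"
    "card {P \<in> l. Gamma_point m P} = card {P \<in> ell mu. Gamma_point m P}"
proof -
  obtain g where g: "l = sact g (ell mu)" "g \<in> SL2" using l unfolding orbit_def by (rule imageE)
  show "P \<notin> tcubic" if P: "P \<in> l"
  proof -
    obtain R where "R \<in> ell mu" "P = pact g R" using P g by (auto simp: sact_def)
    then show ?thesis using pact_tcubic_iff[OF g(2)] ell_not_tcubic ell_subset_PG3 by blast
  qed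
  show "card {P \<in> l. T_point P} = 2"
  proof -
    have "card {P \<in> sact g (ell mu). T_point P} = card {P \<in> ell mu. T_point P}"
      by (rule card_sact_points[OF g(2) ell_subset_PG3]) (rule point_type_pact(1)[OF g(2)])
    then show ?thesis using T_points_ell ell_special_neq g(1) by simp
  qed
  show "card {P \<in> l. Gamma_point m P} = card {P \<in> ell mu. Gamma_point m P}"
    unfolding g(1) by (rule card_sact_points[OF g(2) ell_subset_PG3]) (rule point_type_pact(2)[OF g(2)])
qed

text \<open>The orbit has |SL(2,q)| / 2 lines and a point type has |SL(2,q)| / k points with k = 6,
  2, 3. Double counting therefore gives 2 n = k times the number of such points on the line. For
  T-points the size is q (q + 1) and the line contains two.\<close>

lemma orbit_line_counts:
  shows "T_point P \<Longrightarrow> card {l \<in> orbit (ell mu). P \<in> l} + 1 = card (UNIV :: 'a set)"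
    "Gamma_point 3 P \<Longrightarrow> card {l \<in> orbit (ell mu). P \<in> l} = 3 * card {P \<in> ell mu. Gamma_point 3 P}"
    "Gamma_point 1 P \<Longrightarrow> card {l \<in> orbit (ell mu). P \<in> l} = card {P \<in> ell mu. Gamma_point 1 P}"
    "Gamma_point 0 P \<Longrightarrow> 2 * card {l \<in> orbit (ell mu). P \<in> l} = 3 * card {P \<in> ell mu. Gamma_point 0 P}"
proof -
  let ?q = "card (UNIV :: 'a set)" and ?n = "card {l \<in> orbit (ell mu). P \<in> l}"
  have q: "?q \<noteq> 0" by simp
  have S: "card (SL2 :: 'a mat2 set) = 2 * card (orbit (ell mu))"
    by (rule card_orbit[OF ell_subset_PG3 card_ell_stab])
  have S0: "card (SL2 :: 'a mat2 set) \<noteq> 0" using one_SL2 by (auto simp: card_eq_0_iff)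
  have G: "?n * card {P :: 'a vec4 set. Gamma_point m P} = card (orbit (ell mu)) * card {P \<in> ell mu. Gamma_point m P}"
    if "m \<in> {0, 1, 3}" "Gamma_point m P" for m
    by (rule line_count[where X = "Gamma_point m", OF ell_subset_PG3])
      (auto simp: point_type_pact that intro: Gamma_points_transitive[OF that(1)], simp add: Gamma_point_def)
  have cancel: "x = y" if "card (SL2 :: 'a mat2 set) * x = card (SL2 :: 'a mat2 set) * y" for x y :: nat
    using that S0 by simp
  show "?n + 1 = ?q" if T: "T_point P"
  proof -
    have "?n * card {P :: 'a vec4 set. T_point P} = card (orbit (ell mu)) * card {P \<in> ell mu. T_point P}"
      by (rule line_count[where X = T_point, OF ell_subset_PG3])
        (auto simp: point_type_pact T intro: T_points_transitive, simp add: T_point_def)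
    also have "card {P \<in> ell mu. T_point P} = 2" unfolding T_points_ell using ell_special_neq by simp
    finally have "?n * ((?q + 1) * ?q) = ?q * (?q - 1) * (?q + 1)"
      using S by (simp add: card_T_points card_SL2 mult.commute)
    then have "((?q + 1) * ?q) * ?n = ((?q + 1) * ?q) * (?q - 1)" by (simp only: ac_simps)
    then have "?n = ?q - 1" using q by (simp only: mult_cancel_left) auto
    then show ?thesis using q by linarith
  qed
  have gen: "2 * ?n = k * card {P \<in> ell mu. Gamma_point m P}"
    if m: "m \<in> {0, 1, 3}" "Gamma_point m P"
      and k: "k * card {P :: 'a vec4 set. Gamma_point m P} = card (SL2 :: 'a mat2 set)" for m k
  proof (rule cancel)
    have "card (SL2 :: 'a mat2 set) * (2 * ?n) = 2 * k * (?n * card {P :: 'a vec4 set. Gamma_point m P})"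
      unfolding k[symmetric] by (simp only: ac_simps)
    also have "\<dots> = 2 * k * (card (orbit (ell mu)) * card {P \<in> ell mu. Gamma_point m P})"
      by (simp only: G[OF m])
    also have "\<dots> = card (SL2 :: 'a mat2 set) * (k * card {P \<in> ell mu. Gamma_point m P})"
      unfolding S by (simp only: ac_simps)
    finally show "card (SL2 :: 'a mat2 set) * (2 * ?n) =
        card (SL2 :: 'a mat2 set) * (k * card {P \<in> ell mu. Gamma_point m P})" .
  qed
  show "?n = 3 * card {P \<in> ell mu. Gamma_point 3 P}" if "Gamma_point 3 P"
    using gen[OF _ that card_Gamma_points(1)] by simp
  show "?n = card {P \<in> ell mu. Gamma_point 1 P}" if "Gamma_point 1 P"
    using gen[OF _ that card_Gamma_points(2)] by simp
  show "2 * ?n = 3 * card {P \<in> ell mu. Gamma_point 0 P}" if "Gamma_point 0 P"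
    using gen[OF _ that card_Gamma_points(3)] by simp
qed

end


section \<open>Duality\<close>

definition perp :: "'a vec4 set set \<Rightarrow> 'a vec4 set set" where
  "perp L = {R \<in> PG3. \<forall>P\<in>L. orth R P}"

lemma perp_subset_PG3: "perp L \<subseteq> PG3"
  by (auto simp: perp_def)

lemma subset_polarp_iff: "L \<subseteq> PG3 \<Longrightarrow> R \<in> PG3 \<Longrightarrow> L \<subseteq> polarp R \<longleftrightarrow> R \<in> perp L"
  by (auto simp: polarp_def perp_def)

lemma perp_sact:
  assumes "g \<in> SL2" "L \<subseteq> PG3" shows "perp (sact g L) = sact g (perp L)"
proof (intro equalityI subsetI)
  fix R assume R: "R \<in> perp (sact g L)"
  then have R': "R \<in> PG3" by (simp add: perp_def)
  let ?S = "pact (minv g) R"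
  have S: "?S \<in> PG3" "pact g ?S = R"
    using R' pact_in_PG3[OF minv_SL2[OF assms(1)]] pact_minv(2)[OF assms(1)] by auto
  have "orth ?S P" if P: "P \<in> L" for P
  proof -
    have "orth (pact g ?S) (pact g P)" unfolding S(2) using R P by (auto simp: perp_def sact_def)
    moreover have "P \<in> PG3" using P assms(2) by blast
    ultimately show ?thesis using orth_pact[OF assms(1) S(1)] by blast
  qed
  then have "?S \<in> perp L" using S by (simp add: perp_def)
  then have "pact g ?S \<in> sact g (perp L)" unfolding sact_def by (rule imageI)
  then show "R \<in> sact g (perp L)" unfolding S(2) .
next
  fix R assume "R \<in> sact g (perp L)"
  then obtain S where S: "R = pact g S" "S \<in> perp L" unfolding sact_def by (rule imageE)
  then have S': "S \<in> PG3" "\<And>P. P \<in> L \<Longrightarrow> orth S P" by (auto simp: perp_def)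
  have "orth R (pact g P)" if "P \<in> L" for P
    using that S' S(1) orth_pact[OF assms(1) S'(1), of P] assms(2) by auto
  moreover have "R \<in> PG3" using S(1) pact_in_PG3[OF assms(1) S'(1)] by simp
  ultimately show "R \<in> perp (sact g L)" by (auto simp: perp_def sact_def)
qed

lemma perp_ell: "perp (ell mu) = {pt (v4 (mu * a) b a b) | a b. a \<noteq> 0 \<or> b \<noteq> (0::'a)}"
proof (intro equalityI subsetI)
  fix R assume R: "R \<in> perp (ell mu)"
  then have "R \<in> PG3" by (simp add: perp_def)
  then obtain a b c d where v: "R = pt (v4 a b c d)" "nz (v4 a b c d)" by (rule PG3E)
  have "pt (v4 1 0 1 0) \<in> ell mu" "pt (v4 0 mu 0 1) \<in> ell mu" by (auto simp: ell_eq)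
  then have "orth R (pt (v4 1 0 1 0))" "orth R (pt (v4 0 mu 0 1))" using R by (auto simp: perp_def)
  then have "d = b" "a = mu * c" by (simp_all add: v add_eq_0_iff_eq mult.commute)
  then show "R \<in> {pt (v4 (mu * a) b a b) | a b. a \<noteq> 0 \<or> b \<noteq> 0}" using v by auto
next
  fix R assume "R \<in> {pt (v4 (mu * a) b a b) | a b. a \<noteq> 0 \<or> b \<noteq> 0}"
  then obtain a b where v: "R = pt (v4 (mu * a) b a b)" "a \<noteq> 0 \<or> b \<noteq> 0" by blast
  then have "R \<in> PG3" by auto
  moreover have "orth R P" if P: "P \<in> ell mu" for P
  proof -
    obtain c d where "P = pt (v4 d (c * mu) d c)" using P unfolding ell_eq_pts by blast
    then show ?thesis by (simp add: v(1) algebra_simps)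
  qed
  ultimately show "R \<in> perp (ell mu)" by (simp add: perp_def)
qed

lemma perp_perp_ell: "perp (perp (ell mu)) = ell (mu::'a)"
proof (intro equalityI subsetI)
  fix R assume R: "R \<in> perp (perp (ell mu))"
  then have "R \<in> PG3" by (simp add: perp_def)
  then obtain a b c d where v: "R = pt (v4 a b c d)" "nz (v4 a b c d)" by (rule PG3E)
  have "pt (v4 (mu * 1) 0 1 0) \<in> perp (ell mu)"
    unfolding perp_ell by (rule CollectI, rule exI[of _ 1], rule exI[of _ 0]) simp
  moreover have "pt (v4 (mu * 0) 1 0 1) \<in> perp (ell mu)"
    unfolding perp_ell by (rule CollectI, rule exI[of _ 0], rule exI[of _ 1]) simp
  ultimately have "orth R (pt (v4 (mu * 1) 0 1 0))" "orth R (pt (v4 (mu * 0) 1 0 1))"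
    using R unfolding perp_def[of "perp (ell mu)"] by blast+
  then have "b = d * mu" "a = c" by (simp_all add: v add_eq_0_iff_eq)
  then show "R \<in> ell mu" using v unfolding ell_eq_pts by auto
next
  fix R assume R: "R \<in> ell mu"
  then have "R \<in> PG3" using ell_subset_PG3 by blast
  moreover have "orth R P" if "P \<in> perp (ell mu)" for P
    using that R orth_commute by (auto simp: perp_def)
  ultimately show "R \<in> perp (perp (ell mu))" by (simp add: perp_def)
qed

text \<open>On the polar line the coordinates 0 and 2 have ratio mu, on \<open>ell (1 / mu)\<close>
  they are equal. The diagonal element with parameter e multiplies this ratio by e^4, so e is a
  fourth root of mu.\<close>

lemma perp_ell_eq_sact:
  assumes "mu \<noteq> (0::'a)" obtains h where "h \<in> SL2" "perp (ell mu) = sact h (ell (1 / mu))"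
proof -
  obtain f where f: "f^2 = mu" using sqrt_exists by blast
  obtain e where e: "e^2 = f" using sqrt_exists by blast
  have mu: "mu = e^4" using e f by (metis power_mult mult_2 numeral_Bit0 power_even_eq)
  have e0: "e \<noteq> 0" using mu assms by auto
  define h :: "'a mat2" where "h = (e, 0, 0, 1 / e)"
  have h: "h \<in> SL2" using e0 by (simp add: h_def SL2_def)
  have act: "act h (v4 b (a * (1 / mu)) b a) = v4 (mu * (b / e)) (a / e^3) (b / e) (a / e^3)" for a b
    using e0 by (simp add: h_def mu field_simps eval_nat_numeral v4_def)
  have "perp (ell mu) = sact h (ell (1 / mu))"
  proof (intro equalityI subsetI)
    fix P assume "P \<in> perp (ell mu)"
    then obtain a b where ab: "P = pt (v4 (mu * a) b a b)" "a \<noteq> 0 \<or> b \<noteq> 0" unfolding perp_ell by blast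
    let ?R = "pt (v4 (e * a) (e^3 * b * (1 / mu)) (e * a) (e^3 * b))"
    have hR: "pact h ?R = P" unfolding pact_pt act using e0 ab(1) by simp
    have "?R \<in> ell (1 / mu)"
      unfolding ell_eq_pts using ab(2) e0
      by (intro CollectI exI[of _ "e^3 * b"] exI[of _ "e * a"]) auto
    then have "pact h ?R \<in> sact h (ell (1 / mu))" unfolding sact_def by (rule imageI)
    then show "P \<in> sact h (ell (1 / mu))" unfolding hR .
  next
    fix P assume "P \<in> sact h (ell (1 / mu))"
    then obtain R where R: "P = pact h R" "R \<in> ell (1 / mu)" unfolding sact_def by (rule imageE)
    from R(2) obtain a b where ab: "R = pt (v4 b (a * (1 / mu)) b a)" "a \<noteq> 0 \<or> b \<noteq> 0"
      unfolding ell_eq_pts by blast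
    have "P = pt (v4 (mu * (b / e)) (a / e^3) (b / e) (a / e^3))"
      unfolding R(1) ab(1) pact_pt act ..
    moreover have "b / e \<noteq> 0 \<or> a / e^3 \<noteq> 0" using ab(2) e0 by auto
    ultimately show "P \<in> perp (ell mu)" unfolding perp_ell by blast
  qed
  then show ?thesis using that h by blast
qed

text \<open>Polarity commutes with the group and is an involution on these lines; applying the
  inclusion of orbits to mu and to 1/mu gives both directions.\<close>

lemma perp_orbit:
  assumes "mu \<noteq> (0::'a)"
  shows "bij_betw perp (orbit (ell mu)) (orbit (ell (1 / mu)))"
proof (rule bij_betw_byWitness[where f' = perp])
  have pp: "perp (perp l) = l" if l: "l \<in> orbit (ell mu)" for l and mu :: 'a
  proof -
    obtain g where g: "l = sact g (ell mu)" "g \<in> SL2" using l unfolding orbit_def by (rule imageE)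
    then show ?thesis by (simp add: perp_sact perp_perp_ell ell_subset_PG3 perp_subset_PG3)
  qed
  have im: "perp ` orbit (ell mu) \<subseteq> orbit (ell (1 / mu))" if mu0: "mu \<noteq> 0" for mu :: 'a
  proof
    fix k assume "k \<in> perp ` orbit (ell mu)"
    then obtain g where g: "k = perp (sact g (ell mu))" "g \<in> SL2" by (auto simp: orbit_def)
    obtain h where h: "h \<in> SL2" "perp (ell mu) = sact h (ell (1 / mu))"
      using mu0 by (rule perp_ell_eq_sact)
    have "k = sact (mmul g h) (ell (1 / mu))"
      using g h(2) by (simp add: perp_sact ell_subset_PG3 sact_mmul)
    then show "k \<in> orbit (ell (1 / mu))" using g(2) h(1) mmul_SL2 unfolding orbit_def by blast
  qed
  show "\<forall>l\<in>orbit (ell mu). perp (perp l) = l" "\<forall>l\<in>orbit (ell (1 / mu)). perp (perp l) = l"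
    using pp by blast+
  show "perp ` orbit (ell mu) \<subseteq> orbit (ell (1 / mu))" using im[OF assms] .
  show "perp ` orbit (ell (1 / mu)) \<subseteq> orbit (ell mu)" using im[of "1 / mu"] assms by simp
qed

text \<open>Two roots occur only on the quadric, and 0 or 3 roots only off it. A single root occurs
  in both places, but on the quadric it means a cubic point, whose polar plane is a
  \<open>\<Gamma>\<close>-plane and is excluded by \<open>C_plane\<close>.\<close>

lemma C_plane_type:
  assumes "R \<in> PG3"
  shows "C_plane 2 (polarp R) \<longleftrightarrow> T_point R"
    "d \<in> {0, 1, 3} \<Longrightarrow> C_plane d (polarp R) \<longleftrightarrow> Gamma_point d R"
proof -
  obtain p q r s where v: "R = pt (v4 p q r s)" "nz (v4 p q r s)" using assms by (rule PG3E)
  let ?v = "v4 p q r s"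
  have n: "qform ?v = 0 \<Longrightarrow> nroots ?v \<in> {1, 2}" "qform ?v \<noteq> 0 \<Longrightarrow> nroots ?v \<in> {0, 1, 3}"
    using nroots_singular[OF v4_in_vecs v(2)] nroots_nonsingular[OF v4_in_vecs] by blast+
  show "C_plane 2 (polarp R) \<longleftrightarrow> T_point R"
    unfolding v(1) C_plane_pt_iff[OF v4_in_vecs v(2)] T_point_pt_iff[OF v4_in_vecs v(2)]
    using n by (cases "qform ?v = 0") (auto simp del: qform_v4)
  show "C_plane d (polarp R) \<longleftrightarrow> Gamma_point d R" if "d \<in> {0, 1, 3}"
    unfolding v(1) C_plane_pt_iff[OF v4_in_vecs v(2)] Gamma_point_pt_iff[OF v4_in_vecs v(2)]
    using n that by (cases "qform ?v = 0") (auto simp del: qform_v4)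
qed

text \<open>A plane contains a line exactly when its pole lies on the polar line.\<close>

lemma card_planes_through:
  assumes "l \<subseteq> PG3"
  shows "card {p. C_plane d p \<and> l \<subseteq> p} = card {R \<in> perp l. C_plane d (polarp R)}"
proof -
  have "{p. C_plane d p \<and> l \<subseteq> p} = polarp ` {R \<in> perp l. C_plane d (polarp R)}"
  proof (intro equalityI subsetI)
    fix p assume p: "p \<in> {p. C_plane d p \<and> l \<subseteq> p}"
    then have "p \<in> polarp ` PG3" by (simp add: C_plane_def flip: planes_eq)
    then obtain R where "p = polarp R" "R \<in> PG3" by (rule imageE)
    then show "p \<in> polarp ` {R \<in> perp l. C_plane d (polarp R)}"
      using p subset_polarp_iff[OF assms] by blast
  next
    fix p assume "p \<in> polarp ` {R \<in> perp l. C_plane d (polarp R)}"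
    then obtain R where "p = polarp R" "R \<in> perp l" "C_plane d (polarp R)" by blast
    then show "p \<in> {p. C_plane d p \<and> l \<subseteq> p}"
      using subset_polarp_iff[OF assms] perp_subset_PG3 by blast
  qed
  moreover have "inj_on polarp {R \<in> perp l. C_plane d (polarp R)}"
    using perp_subset_PG3 by (intro inj_on_subset[OF inj_on_polarp]) blast
  ultimately show ?thesis by (simp add: card_image)
qed

text \<open>The lines of the orbit in a plane become, under the polarity, the lines of the dual
  orbit through its pole.\<close>

lemma card_lines_in_polarp:
  assumes "mu \<noteq> (0::'a)" "R \<in> PG3"
  shows "card {l \<in> orbit (ell mu). l \<subseteq> polarp R} = card {l \<in> orbit (ell (1 / mu)). R \<in> l}"
proof (rule bij_betw_same_card[of perp])
  have "l \<subseteq> polarp R \<longleftrightarrow> R \<in> perp l" if "l \<in> orbit (ell mu)" for l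
    using subset_polarp_iff[OF orbit_subset_PG3[OF ell_subset_PG3 that] assms(2)] .
  then have "{l \<in> orbit (ell mu). l \<subseteq> polarp R} = {l \<in> orbit (ell mu). R \<in> perp l}"
    by (intro Collect_cong conj_cong refl)
  moreover have "bij_betw perp {l \<in> orbit (ell mu). R \<in> perp l} {l \<in> orbit (ell (1 / mu)). R \<in> l}"
    using perp_orbit[OF assms(1)] unfolding bij_betw_def by (auto intro: inj_on_subset)
  ultimately show "bij_betw perp {l \<in> orbit (ell mu). l \<subseteq> polarp R} {l \<in> orbit (ell (1 / mu)). R \<in> l}"
    by simp
qed

text \<open>With s^2 = 1/mu, the substitution t = s u and g = s c turns the cubic for 1/mu into s^3
  times the one counted by \<open>N1t\<close>.\<close>

lemma N1_inverse:
  assumes "mu \<noteq> (0::'a)" shows "N1 (1 / mu) = N1t mu"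
proof -
  obtain s where s: "s^2 = 1 / mu" using sqrt_exists by blast
  have s0: "s \<noteq> 0" using s assms by auto
  have mus: "mu * s^2 = 1" using s assms by simp
  let ?A = "\<lambda>g. {t. t^3 + g * t^2 + 1 / mu * t + g = 0}"
  let ?B = "\<lambda>c. {t. t^3 + c * t^2 + t + mu * c = 0}"
  have AB: "card (?A (s * c)) = card (?B c)" for c
  proof -
    have key: "(s * u)^3 + s * c * (s * u)^2 + 1 / mu * (s * u) + s * c
        = s^3 * (u^3 + c * u^2 + u + mu * c)" for u
    proof -
      have "s^3 * (u^3 + c * u^2 + u + mu * c) = (s * u)^3 + s * c * (s * u)^2 + s^2 * (s * u) + mu * s^2 * (s * c)"
        by (simp add: algebra_simps power2_eq_square power3_eq_cube)
      then show ?thesis unfolding mus s using assms by simp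
    qed
    have "?A (s * c) = (\<lambda>u. s * u) ` ?B c"
    proof (intro equalityI subsetI)
      fix t assume t: "t \<in> ?A (s * c)"
      have ts: "t = s * (t / s)" using s0 by simp
      have "t / s \<in> ?B c" using t key[of "t / s"] s0 by simp
      then show "t \<in> (\<lambda>u. s * u) ` ?B c" by (rule image_eqI[where f = "\<lambda>u. s * u", OF ts])
    next
      fix t assume "t \<in> (\<lambda>u. s * u) ` ?B c"
      then obtain u where u: "t = s * u" "u^3 + c * u^2 + u + mu * c = 0" by auto
      show "t \<in> ?A (s * c)" unfolding u(1) mem_Collect_eq key u(2) by simp
    qed
    then show ?thesis using s0 by (simp add: card_image inj_on_def)
  qed
  \<comment> \<open>\<open>N1t\<close> excludes c = 0 whereas \<open>N1\<close> excludes no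
    parameter; nothing is lost, since t^3 + t = t (t + 1)^2 has two roots.\<close>
  have "card (?B 0) = 2"
  proof -
    have "t^3 + 0 * t^2 + t + mu * 0 = t * (t + 1)^2" for t
      by (simp add: sq_add algebra_simps power2_eq_square power3_eq_cube)
    then have "?B 0 = {0, 1}" by (auto simp: add_eq_0_iff_eq)
    then show ?thesis by simp
  qed
  then have nz: "c \<noteq> 0" if "card (?B c) = 1" for c using that by auto
  have "{g. card (?A g) = 1} = (\<lambda>c. s * c) ` {c. c \<noteq> 0 \<and> card (?B c) = 1}"
  proof (intro equalityI subsetI)
    fix g assume g: "g \<in> {g. card (?A g) = 1}"
    have gs: "g = s * (g / s)" using s0 by simp
    have "card (?B (g / s)) = 1" using g AB[of "g / s"] unfolding gs[symmetric] by simp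
    then have "g / s \<in> {c. c \<noteq> 0 \<and> card (?B c) = 1}" using nz by blast
    then show "g \<in> (\<lambda>c. s * c) ` {c. c \<noteq> 0 \<and> card (?B c) = 1}" 
      by (rule image_eqI[where f = "\<lambda>c. s * c", OF gs])
  next
    fix g assume "g \<in> (\<lambda>c. s * c) ` {c. c \<noteq> 0 \<and> card (?B c) = 1}"
    then obtain c where "g = s * c" "card (?B c) = 1" by auto
    then show "g \<in> {g. card (?A g) = 1}" using AB[of c] by simp
  qed
  then show ?thesis
    unfolding N1_def N1t_def using s0 by (simp add: card_image inj_on_def)
qed

lemma ell_orbit_point_numbers:
  assumes mu: "mu \<noteq> 0" "mu \<noteq> (1::'a)"
  defines "q \<equiv> int (card (UNIV :: 'a set))"
  shows "l \<in> orbit (ell mu) \<Longrightarrow> card {P \<in> l. T_point P} = 2"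
    "l \<in> orbit (ell mu) \<Longrightarrow> 3 * int (card {P \<in> l. Gamma_point 3 P}) = q - 3 - int (N1 mu)"
    "l \<in> orbit (ell mu) \<Longrightarrow> card {P \<in> l. Gamma_point 1 P} = N1 mu"
    "l \<in> orbit (ell mu) \<Longrightarrow> 3 * int (card {P \<in> l. Gamma_point 0 P}) = 2 * (q - int (N1 mu))"
    "T_point P \<Longrightarrow> int (card {l \<in> orbit (ell mu). P \<in> l}) = q - 1"
    "Gamma_point 3 P \<Longrightarrow> int (card {l \<in> orbit (ell mu). P \<in> l}) = q - 3 - int (N1 mu)"
    "Gamma_point 1 P \<Longrightarrow> card {l \<in> orbit (ell mu). P \<in> l} = N1 mu"
    "Gamma_point 0 P \<Longrightarrow> int (card {l \<in> orbit (ell mu). P \<in> l}) = q - int (N1 mu)"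
proof -
  note c = Gamma_ell_counts[OF mu]
  note o = orbit_point_counts[OF mu]
  note n = orbit_line_counts[OF mu]
  show "card {P \<in> l. T_point P} = 2" if "l \<in> orbit (ell mu)" using o(2)[OF that] .
  show "3 * int (card {P \<in> l. Gamma_point 3 P}) = q - 3 - int (N1 mu)" if "l \<in> orbit (ell mu)"
    unfolding o(3)[OF that] q_def using c(2) by linarith
  show "card {P \<in> l. Gamma_point 1 P} = N1 mu" if "l \<in> orbit (ell mu)"
    unfolding o(3)[OF that] by (rule c(1))
  show "3 * int (card {P \<in> l. Gamma_point 0 P}) = 2 * (q - int (N1 mu))" if "l \<in> orbit (ell mu)"
    unfolding o(3)[OF that] q_def using arg_cong[OF c(3), of int] by (simp add: algebra_simps)
  show "int (card {l \<in> orbit (ell mu). P \<in> l}) = q - 1" if "T_point P"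
    unfolding q_def using n(1)[OF that] by linarith
  show "int (card {l \<in> orbit (ell mu). P \<in> l}) = q - 3 - int (N1 mu)" if "Gamma_point 3 P"
    unfolding q_def using n(2)[OF that] c(2) by linarith
  show "card {l \<in> orbit (ell mu). P \<in> l} = N1 mu" if "Gamma_point 1 P"
    using n(3)[OF that] c(1) by simp
  show "int (card {l \<in> orbit (ell mu). P \<in> l}) = q - int (N1 mu)" if "Gamma_point 0 P"
    unfolding q_def using n(4)[OF that] c(3) by linarith
qed

lemma ell_orbit_plane_numbers:
  assumes mu: "mu \<noteq> 0" "mu \<noteq> (1::'a)"
  defines "q \<equiv> int (card (UNIV :: 'a set))"
  shows "l \<in> orbit (ell mu) \<Longrightarrow> card {\<pi>. C_plane 2 \<pi> \<and> l \<subseteq> \<pi>} = 2"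
    "l \<in> orbit (ell mu) \<Longrightarrow> 3 * int (card {\<pi>. C_plane 3 \<pi> \<and> l \<subseteq> \<pi>}) = q - 3 - int (N1t mu)"
    "l \<in> orbit (ell mu) \<Longrightarrow> card {\<pi>. C_plane 1 \<pi> \<and> l \<subseteq> \<pi>} = N1t mu"
    "l \<in> orbit (ell mu) \<Longrightarrow> 3 * int (card {\<pi>. C_plane 0 \<pi> \<and> l \<subseteq> \<pi>}) = 2 * (q - int (N1t mu))"
    "C_plane 2 \<pi> \<Longrightarrow> int (card {l \<in> orbit (ell mu). l \<subseteq> \<pi>}) = q - 1"
    "C_plane 3 \<pi> \<Longrightarrow> int (card {l \<in> orbit (ell mu). l \<subseteq> \<pi>}) = q - 3 - int (N1t mu)"
    "C_plane 1 \<pi> \<Longrightarrow> card {l \<in> orbit (ell mu). l \<subseteq> \<pi>} = N1t mu"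
    "C_plane 0 \<pi> \<Longrightarrow> int (card {l \<in> orbit (ell mu). l \<subseteq> \<pi>}) = q - int (N1t mu)"
    "l \<in> orbit (ell mu) \<Longrightarrow> \<pi> \<in> gamma_planes \<Longrightarrow> \<not> l \<subseteq> \<pi>"
proof -
  have mu': "1 / mu \<noteq> 0" "1 / mu \<noteq> 1" using mu by auto
  \<comment> \<open>All plane numbers are the point numbers of the dual orbit, that of 1/mu, with
    \<open>N1 (1 / mu)\<close> rewritten.\<close>
  note p = ell_orbit_point_numbers[OF mu', folded q_def, unfolded N1_inverse[OF mu(1)]]
  have perp: "perp l \<in> orbit (ell (1 / mu))" if "l \<in> orbit (ell mu)" for l
    using perp_orbit[OF mu(1)] that by (auto simp: bij_betw_def)
  note lP = orbit_subset_PG3[OF ell_subset_PG3]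
  have eq2: "{R \<in> perp l. C_plane 2 (polarp R)} = {R \<in> perp l. T_point R}" for l
    using C_plane_type(1) perp_subset_PG3 by blast
  have eqd: "{R \<in> perp l. C_plane d (polarp R)} = {R \<in> perp l. Gamma_point d R}" if "d \<in> {0, 1, 3}" for l d
    using C_plane_type(2)[OF _ that] perp_subset_PG3 by blast
  show "card {\<pi>. C_plane 2 \<pi> \<and> l \<subseteq> \<pi>} = 2" if l: "l \<in> orbit (ell mu)"
    unfolding card_planes_through[OF lP[OF l]] eq2 by (rule p(1)[OF perp[OF l]])
  show "3 * int (card {\<pi>. C_plane 3 \<pi> \<and> l \<subseteq> \<pi>}) = q - 3 - int (N1t mu)" if l: "l \<in> orbit (ell mu)"
    unfolding card_planes_through[OF lP[OF l]] using p(2)[OF perp[OF l]] eqd[of 3] by simp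
  show "card {\<pi>. C_plane 1 \<pi> \<and> l \<subseteq> \<pi>} = N1t mu" if l: "l \<in> orbit (ell mu)"
    unfolding card_planes_through[OF lP[OF l]] using p(3)[OF perp[OF l]] eqd[of 1] by simp
  show "3 * int (card {\<pi>. C_plane 0 \<pi> \<and> l \<subseteq> \<pi>}) = 2 * (q - int (N1t mu))" if l: "l \<in> orbit (ell mu)"
    unfolding card_planes_through[OF lP[OF l]] using p(4)[OF perp[OF l]] eqd[of 0] by simp
  have pole: "\<exists>R\<in>PG3. \<pi> = polarp R" if "C_plane d \<pi>" for d
    using that planes_eq by (auto simp: C_plane_def)
  show "int (card {l \<in> orbit (ell mu). l \<subseteq> \<pi>}) = q - 1" if c: "C_plane 2 \<pi>"
  proof -
    obtain R where R: "R \<in> PG3" "\<pi> = polarp R" using pole[OF c] by blast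
    then have "T_point R" using c C_plane_type(1) by blast
    then show ?thesis unfolding R(2) card_lines_in_polarp[OF mu(1) R(1)] by (rule p(5))
  qed
  show "int (card {l \<in> orbit (ell mu). l \<subseteq> \<pi>}) = q - 3 - int (N1t mu)" if c: "C_plane 3 \<pi>"
  proof -
    obtain R where R: "R \<in> PG3" "\<pi> = polarp R" using pole[OF c] by blast
    then have "Gamma_point 3 R" using c C_plane_type(2)[of R 3] by simp
    then show ?thesis unfolding R(2) card_lines_in_polarp[OF mu(1) R(1)] by (rule p(6))
  qed
  show "card {l \<in> orbit (ell mu). l \<subseteq> \<pi>} = N1t mu" if c: "C_plane 1 \<pi>"
  proof -
    obtain R where R: "R \<in> PG3" "\<pi> = polarp R" using pole[OF c] by blast
    then have "Gamma_point 1 R" using c C_plane_type(2)[of R 1] by simp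
    then show ?thesis unfolding R(2) card_lines_in_polarp[OF mu(1) R(1)] by (rule p(7))
  qed
  show "int (card {l \<in> orbit (ell mu). l \<subseteq> \<pi>}) = q - int (N1t mu)" if c: "C_plane 0 \<pi>"
  proof -
    obtain R where R: "R \<in> PG3" "\<pi> = polarp R" using pole[OF c] by blast
    then have "Gamma_point 0 R" using c C_plane_type(2)[of R 0] by simp
    then show ?thesis unfolding R(2) card_lines_in_polarp[OF mu(1) R(1)] by (rule p(8))
  qed
  \<comment> \<open>The pole of a \<open>\<Gamma>\<close>-plane is a cubic point; containment would
    put it on the polar line, and that line misses the cubic.\<close>
  show "\<not> l \<subseteq> \<pi>" if l: "l \<in> orbit (ell mu)" and g: "\<pi> \<in> gamma_planes"
  proof
    assume sub: "l \<subseteq> \<pi>"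
    obtain R where R: "\<pi> = polarp R" "R \<in> tcubic" using g unfolding gamma_planes_eq by (rule imageE)
    then have "R \<in> perp l" using sub subset_polarp_iff[OF lP[OF l]] tcubic_subset_PG3 by blast
    then show False using orbit_point_counts(1)[OF mu' perp[OF l]] R(2) by blast
  qed
qed


end

theorem theorem6p3:
  fixes mu :: "'a::{field,finite}"
  assumes "even (card (UNIV :: 'a set))" and "card (UNIV :: 'a set) \<ge> 8"
    and "mu \<noteq> 0" and "mu \<noteq> 1"
  defines "Orb \<equiv> line_orbit (ell mu)" and "q \<equiv> int (card (UNIV :: 'a set))"
  shows
    "(\<forall>l\<in>Orb. card {\<pi> \<in> gamma_planes. l \<subseteq> \<pi>} = 0)
   \<and> (\<forall>\<pi>\<in>gamma_planes. card {l \<in> Orb. l \<subseteq> \<pi>} = 0)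
   \<and> (\<forall>l\<in>Orb. card {P \<in> l. P \<in> tcubic} = 0)
   \<and> (\<forall>P\<in>tcubic. card {l \<in> Orb. P \<in> l} = 0)
   \<and> (\<forall>l\<in>Orb. card {P \<in> l. T_point P} = 2)
   \<and> (\<forall>l\<in>Orb. 3 * int (card {P \<in> l. Gamma_point 3 P}) = q - 3 - int (N1 mu))
   \<and> (\<forall>l\<in>Orb. card {P \<in> l. Gamma_point 1 P} = N1 mu)
   \<and> (\<forall>l\<in>Orb. 3 * int (card {P \<in> l. Gamma_point 0 P}) = 2 * (q - int (N1 mu)))
   \<and> (\<forall>P. T_point P \<longrightarrow> int (card {l \<in> Orb. P \<in> l}) = q - 1)
   \<and> (\<forall>P. Gamma_point 3 P \<longrightarrow> int (card {l \<in> Orb. P \<in> l}) = q - 3 - int (N1 mu))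
   \<and> (\<forall>P. Gamma_point 1 P \<longrightarrow> card {l \<in> Orb. P \<in> l} = N1 mu)
   \<and> (\<forall>P. Gamma_point 0 P \<longrightarrow> int (card {l \<in> Orb. P \<in> l}) = q - int (N1 mu))
   \<and> (\<forall>l\<in>Orb. card {\<pi>. C_plane 2 \<pi> \<and> l \<subseteq> \<pi>} = 2)
   \<and> (\<forall>l\<in>Orb. 3 * int (card {\<pi>. C_plane 3 \<pi> \<and> l \<subseteq> \<pi>}) = q - 3 - int (N1t mu))
   \<and> (\<forall>l\<in>Orb. card {\<pi>. C_plane 1 \<pi> \<and> l \<subseteq> \<pi>} = N1t mu)
   \<and> (\<forall>l\<in>Orb. 3 * int (card {\<pi>. C_plane 0 \<pi> \<and> l \<subseteq> \<pi>}) = 2 * (q - int (N1t mu)))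
   \<and> (\<forall>\<pi>. C_plane 2 \<pi> \<longrightarrow> int (card {l \<in> Orb. l \<subseteq> \<pi>}) = q - 1)
   \<and> (\<forall>\<pi>. C_plane 3 \<pi> \<longrightarrow> int (card {l \<in> Orb. l \<subseteq> \<pi>}) = q - 3 - int (N1t mu))
   \<and> (\<forall>\<pi>. C_plane 1 \<pi> \<longrightarrow> card {l \<in> Orb. l \<subseteq> \<pi>} = N1t mu)
   \<and> (\<forall>\<pi>. C_plane 0 \<pi> \<longrightarrow> int (card {l \<in> Orb. l \<subseteq> \<pi>}) = q - int (N1t mu))"
proof -
  interpret even_field "TYPE('a)" using assms(1) by unfold_locales
  note mu = assms(3,4)
  have Orb: "Orb = orbit (ell mu)"
    unfolding Orb_def orbit_def by (rule line_orbit_eq[OF assms(2) ell_subset_PG3])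
  have gamma: "{\<pi> \<in> gamma_planes. l \<subseteq> \<pi>} = {}" if "l \<in> orbit (ell mu)" for l
    using ell_orbit_plane_numbers(9)[OF mu that] by blast
  have gamma': "{l \<in> orbit (ell mu). l \<subseteq> \<pi>} = {}" if "\<pi> \<in> gamma_planes" for \<pi>
    using ell_orbit_plane_numbers(9)[OF mu _ that] by blast
  have cubic: "{P \<in> l. P \<in> tcubic} = {}" if "l \<in> orbit (ell mu)" for l
    using orbit_point_counts(1)[OF mu that] by blast
  have cubic': "{l \<in> orbit (ell mu). P \<in> l} = {}" if "P \<in> tcubic" for P
    using orbit_point_counts(1)[OF mu] that by blast
  show ?thesis
    unfolding Orb q_def
    by (intro conjI ballI allI impI ell_orbit_point_numbers[OF mu] ell_orbit_plane_numbers(1-8)[OF mu])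
      (simp_all only: gamma gamma' cubic cubic' card.empty)
qed

end
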